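(* Let $\mu=\mathcal{GW}(\{q_k\})$ be a Galton-Watson measure on $\mathcal{T}^{|}$ with $q_1=0$ and progeny generating function $Q$, and let $T$ be a random tree in $\mathcal{T}^{|}$ with distribution $\mu$. For $p\in[0,1)$ let $\mathcal{C}_p$ denote the Bernoulli leaf coloring operator. (i) Suppose that $\mu$ is critical and that the limit $\lim_{x\to1-}\frac{Q(x)-x}{(1-x)(1-Q'(x))}$ exists. Then $$\lim_{p\to1-}\mathsf{P}\big(\mathcal{C}_p(T)=\tau\,\big|\,\mathcal{C}_p(T)\ne\phi\big)=\mu^*(\tau)\qquad\text{for all }\tau\in\mathcal{T}^{|},$$ where $\mu^*$ denotes the invariant Galton-Watson measure $\mathcal{IGW}(q)$ with $q=\frac{1}{2-L}$ and $L=\lim_{x\to1-}\frac{\ln g(x)}{-\ln(1-x)}$. (ii) Suppose that $\mu$ is subcritical. Then the conditional distribution $\mathsf{P}\big(\mathcal{C}_p(T)=\cdot\,\big|\,\mathcal{C}_p(T)\ne\phi\big)$ converges, as $p\to1-$, to the point mass measure $\mathcal{GW}(q_0=1)$.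
   Context: Trees. A rooted tree is reduced if it has no vertices of degree 2 except possibly the root, and planted if its root has degree one. $\mathcal{T}^{|}$ is the space of finite unlabeled rooted reduced planted trees without planar embedding, together with the empty tree $\phi$ (a root and no edges). Galton-Watson measures. For a p.m.f. $\{q_k\}_{k\ge 0}$ with $q_1=0$ and $\sum_k kq_k\le1$, $\mathcal{GW}(\{q_k\})$ is the law on $\mathcal{T}^{|}$ of the tree of the Galton-Watson process started from a progenitor (the root) with exactly one offspring, after which each individual independently has $k$ offspring with probability $q_k$. It is critical if $\sum_k kq_k=1$ and subcritical if $\sum_k kq_k<1$. The progeny generating function is $Q(z)=\sum_k q_kz^k$. For $q\in[1/2,1)$, the invariant Galton-Watson measure $\mathcal{IGW}(q)$ is the critical Galton-Watson measure on $\mathcal{T}^{|}$ with progeny generating function $z+q(1-z)^{1/q}$. $\mathcal{GW}(q_0=1)$ is the Galton-Watson measure with $q_0=1$. The function $g$ is $g(x)=\sum_{m=0}^\infty\sum_{k=m+1}^\infty(k-m-1)q_k\,x^m$, so that in the critical case $Q(x)-x=(1-x)^2g(x)$. In the critical case, when the limit $\lim_{x\to1-}\frac{Q(x)-x}{(1-x)(1-Q'(x))}$ exists, the limit $L$ is known to exist. Bernoulli leaf coloring. Fix $p\in[0,1)$. For a finite tree $T\in\mathcal{T}^{|}$, each leaf is selected independently with probability $1-p$ (independently of everything else), and $\mathcal{C}_p(T)$ is the minimal subtree of $T$ containing all selected leaves and the root $\rho$, regarded as an element of $\mathcal{T}^{|}$ (non-root degree-two vertices are removed by merging adjacent edges);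 $\mathcal{C}_p(T)=\phi$ if no leaf is selected. *)

theory Defs
  imports "HOL-Probability.Probability" "HOL-Library.Multiset"
begin

text \<open>
  Finite unlabeled rooted trees without planar embedding: a vertex is given by the multiset of
  the subtrees hanging off it.
\<close>

datatype tree = Node (subtrees: "tree multiset")

definition empty_tree :: tree where
  "empty_tree = Node {#}"

text \<open>
  \<open>no_unary t\<close>: no vertex of \<open>t\<close>, its top vertex included, has exactly one child. If \<open>t\<close> hangs off
  a parent, then a vertex of \<open>t\<close> with \<open>k\<close> children has degree \<open>k + 1\<close>, so this says that no vertex
  of \<open>t\<close> has degree 2.
\<close>

inductive no_unary :: "tree \<Rightarrow> bool" where
  "size C \<noteq> 1 \<Longrightarrow> (\<And>t. t \<in># C \<Longrightarrow> no_unary t) \<Longrightarrow> no_unary (Node C)"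

definition reduced :: "tree \<Rightarrow> bool" where
  "reduced T \<longleftrightarrow> (\<forall>t\<in>#subtrees T. no_unary t)"

definition planted :: "tree \<Rightarrow> bool" where
  "planted T \<longleftrightarrow> size (subtrees T) = 1"

definition planted_trees :: "tree set" where
  "planted_trees = {T. reduced T \<and> planted T} \<union> {empty_tree}"


text \<open>
  \<open>gw_forest q n\<close> is the law of the multiset of the family trees of \<open>n\<close> individuals, each individual
  independently having \<open>k\<close> offspring with probability \<open>pmf q k\<close>. It is the least fixed point, so
  the mass that it lacks is the probability that the total progeny is infinite; there is none when
  \<open>pmf q 1 = 0\<close> and the mean offspring number is at most 1.
\<close>

partial_function (spmf) gw_forest :: "nat pmf \<Rightarrow> nat \<Rightarrow> tree multiset spmf" where
  "gw_forest q n =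
     (case n of
        0 \<Rightarrow> return_spmf {#}
      | Suc m \<Rightarrow>
          bind_spmf (spmf_of_pmf q) (\<lambda>k.
          bind_spmf (gw_forest q k) (\<lambda>C.
          bind_spmf (gw_forest q m) (\<lambda>F.
          return_spmf (add_mset (Node C) F)))))"

text \<open>The progenitor, which is the root, has exactly one offspring.\<close>

definition GW :: "nat pmf \<Rightarrow> tree spmf" where
  "GW q = map_spmf Node (gw_forest q 1)"

definition critical :: "nat pmf \<Rightarrow> bool" where
  "critical q \<longleftrightarrow> (\<lambda>k. real k * pmf q k) sums 1"

definition subcritical :: "nat pmf \<Rightarrow> bool" where
  "subcritical q \<longleftrightarrow> (\<exists>m<1. (\<lambda>k. real k * pmf q k) sums m)"

definition progeny_gf :: "nat pmf \<Rightarrow> real \<Rightarrow> real" where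
  "progeny_gf q z = (\<Sum>k. pmf q k * z ^ k)"

definition g_fun :: "nat pmf \<Rightarrow> real \<Rightarrow> real" where
  "g_fun q x =
     (\<Sum>m. (\<Sum>k. if m + 1 \<le> k then (real k - real m - 1) * pmf q k else 0) * x ^ m)"

text \<open>
  A distribution on the natural numbers is determined by its generating function on \<open>[0, 1]\<close>.
  The one required here exists for \<open>1/2 \<le> q \<le> 1\<close>. It is critical for \<open>q < 1\<close>; at the boundary
  value \<open>q = 1\<close> the generating function is constantly 1, so that \<open>IGW 1 = GW (return_pmf 0)\<close>.
\<close>

definition igw_offspring :: "real \<Rightarrow> nat pmf" where
  "igw_offspring q =
     (THE r. \<forall>z\<in>{0..1}. progeny_gf r z = z + q * (1 - z) powr (1 / q))"

definition IGW :: "real \<Rightarrow> tree spmf" where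
  "IGW q = GW (igw_offspring q)"


text \<open>The law of the multiset of independent samples, one from each distribution in a multiset.\<close>

definition indep_mset :: "'a pmf multiset \<Rightarrow> 'a multiset pmf" where
  "indep_mset =
     fold_mset (\<lambda>P R. bind_pmf P (\<lambda>x. map_pmf (add_mset x) R)) (return_pmf {#})"

interpretation indep_mset: comp_fun_commute
  "\<lambda>(P :: 'a pmf) R. bind_pmf P (\<lambda>x. map_pmf (add_mset x) R)"
proof
  show "(\<lambda>R. bind_pmf P (\<lambda>x. map_pmf (add_mset x) R)) \<circ>
          (\<lambda>R. bind_pmf P' (\<lambda>x. map_pmf (add_mset x) R)) =
        (\<lambda>R. bind_pmf P' (\<lambda>x. map_pmf (add_mset x) R)) \<circ>
          (\<lambda>R. bind_pmf P (\<lambda>x. map_pmf (add_mset x) R))"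
    for P P' :: "'a pmf"
    by (rule ext)
      (simp add: map_bind_pmf pmf.map_comp o_def bind_commute_pmf[of P P'] add_mset_commute)
qed

lemma indep_mset_empty [simp]: "indep_mset {#} = return_pmf {#}"
  by (simp add: indep_mset_def)

lemma indep_mset_add_mset [simp]:
  "indep_mset (add_mset P A) = bind_pmf P (\<lambda>x. map_pmf (add_mset x) (indep_mset A))"
  by (simp add: indep_mset_def)

text \<open>Trees with a marking of the vertices; \<open>True\<close> marks the selected leaves.\<close>

datatype marked_tree = MNode bool "marked_tree multiset"

text \<open>
  Random selection in the part of a tree hanging off a parent, where the leaves are the vertices
  without children. The root itself is never a leaf.
\<close>

primrec select_leaves :: "real \<Rightarrow> tree \<Rightarrow> marked_tree pmf" where
  "select_leaves p (Node C) =
     (if C = {#} then map_pmf (\<lambda>b. MNode b {#}) (bernoulli_pmf (1 - p))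
      else map_pmf (MNode False) (indep_mset (image_mset (select_leaves p) C)))"

definition select_leaves_root :: "real \<Rightarrow> tree \<Rightarrow> marked_tree pmf" where
  "select_leaves_root p T =
     map_pmf (MNode False) (indep_mset (image_mset (select_leaves p) (subtrees T)))"

inductive has_selected :: "marked_tree \<Rightarrow> bool" where
  here: "has_selected (MNode True C)"
| below: "t \<in># C \<Longrightarrow> has_selected t \<Longrightarrow> has_selected (MNode b C)"

text \<open>
  The minimal subtree containing the root and the selected leaves: besides the root, it consists
  of the vertices that have a selected leaf among themselves and their descendants.
\<close>

context
  notes multiset.map_cong [fundef_cong]
begin

function minimal_subtree :: "marked_tree \<Rightarrow> tree" where
  "minimal_subtree (MNode b C) =
     Node (image_mset minimal_subtree (filter_mset has_selected C))"
  by pat_completeness auto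
termination
  by (relation "Wellfounded.measure size") (auto dest!: multi_member_split)

end

text \<open>
  Removal of the degree-two vertices: a non-root vertex with a single child is replaced by that
  child, whereas the root is kept.
\<close>

definition merge_vertex :: "tree multiset \<Rightarrow> tree" where
  "merge_vertex D = (if size D = 1 then (THE t. D = {#t#}) else Node D)"

primrec merge_edges :: "tree \<Rightarrow> tree" where
  "merge_edges (Node C) = merge_vertex (image_mset merge_edges C)"

definition merge_edges_root :: "tree \<Rightarrow> tree" where
  "merge_edges_root T = Node (image_mset merge_edges (subtrees T))"

text \<open>The law of the randomly coloured tree \<open>C\<^sub>p(T)\<close>, for a fixed tree and for a random one.\<close>

definition leaf_coloring :: "real \<Rightarrow> tree \<Rightarrow> tree pmf" where
  "leaf_coloring p T =
     map_pmf (\<lambda>M. merge_edges_root (minimal_subtree M)) (select_leaves_root p T)"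

definition colored_law :: "real \<Rightarrow> tree spmf \<Rightarrow> tree spmf" where
  "colored_law p \<mu> = bind_spmf \<mu> (\<lambda>T. spmf_of_pmf (leaf_coloring p T))"

end

theory Submission
  imports Defs
begin

text \<open>
  Call a branch erased if none of its leaves is selected, and let \<open>x\<close> be the probability of this
  event. Conditioning on the offspring number of the top vertex gives
  \<open>Q x - x = pmf q 0 * (1 - p)\<close>, so that \<open>x\<close> tends to 1 as \<open>p\<close> does, and shows that the pruned
  branch, conditioned not to be erased, is again a Galton--Watson branch whose offspring
  distribution has the generating function
  \<open>z + (Q y - y) / ((1 - x) * (1 - Q' x))\<close> with \<open>y = x + (1 - x) * z\<close>.
  In the critical case let \<open>\<Lambda>\<close> be the limit in the hypothesis. By the mean value theorem
  \<open>Q x - x\<close> is regularly varying at 1 with index \<open>1 / \<Lambda>\<close>; hence \<open>L = 2 - 1 / \<Lambda>\<close>, and these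
  generating functions converge to \<open>z + \<Lambda> * (1 - z) powr (1 / \<Lambda>)\<close>. Then the offspring
  probabilities converge too, and the probability of a fixed tree is a polynomial in finitely many
  of them. In the subcritical case the probability of no offspring tends to 1.
\<close>

section \<open>Generating functions\<close>

lemma eventually_at_left_1_unit: "\<forall>\<^sub>F x in at_left 1. x \<in> {0<..<1::real}"
  by (rule eventually_at_left_real) simp

text \<open>A continuity theorem for generating functions, coefficient by coefficient. Once the
  terms below \<open>k\<close> are removed and the rest is divided by \<open>z ^ k\<close>, the
  bounds on the coefficients leave an error of at most \<open>z / (1 - z)\<close>, uniformly in
  \<open>x\<close>; so \<open>z\<close> is fixed first and the limit in \<open>x\<close> is taken
  afterwards.\<close>

lemma power_series_coeff_tendsto:
  fixes r :: "'a \<Rightarrow> nat \<Rightarrow> real" and c :: "nat \<Rightarrow> real"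
  assumes bd: "\<forall>\<^sub>F x in F. \<forall>j. 0 \<le> r x j \<and> r x j \<le> 1"
    and lim: "\<And>z. 0 < z \<Longrightarrow> z < 1 \<Longrightarrow> ((\<lambda>x. \<Sum>j. r x j * z ^ j) \<longlongrightarrow> G z) F"
    and c: "\<And>z. 0 < z \<Longrightarrow> z < 1 \<Longrightarrow> (\<lambda>j. c j * z ^ j) sums G z"
  shows "((\<lambda>x. r x k) \<longlongrightarrow> c k) F"
proof (induction k rule: less_induct)
  case (less k)
  define D where "D z = (G z - (\<Sum>j<k. c j * z ^ j)) / z ^ k" for z
  define E where "E x z = ((\<Sum>j. r x j * z ^ j) - (\<Sum>j<k. r x j * z ^ j)) / z ^ k" for x z
  have Dsums: "(\<lambda>j. c (j + k) * z ^ j) sums D z" if "0 < z" "z < 1" for z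
  proof -
    have "(\<lambda>j. c (j + k) * z ^ (j + k)) sums (G z - (\<Sum>j<k. c j * z ^ j))"
      using sums_split_initial_segment[OF c[OF that], of k] by simp
    from sums_divide[OF this, of "z ^ k"] show ?thesis
      using that by (simp add: D_def power_add)
  qed
  \<comment> \<open>\<open>powser_limit_0\<close> asks for convergence on both sides of 0, which
    follows from convergence at the single point \<open>1/2\<close>.\<close>
  have "((\<lambda>z. \<Sum>j. c (j + k) * z ^ j) \<longlongrightarrow> c (0 + k)) (at 0)"
  proof (rule powser_limit_0[where s = "1/2"])
    fix z :: real assume "norm z < 1/2"
    then have "summable (\<lambda>j. c (j + k) * z ^ j)"
      by (intro powser_inside[OF sums_summable[OF Dsums[of "1/2"]]]) auto
    then show "(\<lambda>j. c (j + k) * z ^ j) sums (\<Sum>j. c (j + k) * z ^ j)" by (rule summable_sums)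
  qed simp
  then have "((\<lambda>z. \<Sum>j. c (j + k) * z ^ j) \<longlongrightarrow> c k) (at_right 0)"
    by (simp add: filterlim_at_split)
  moreover have "\<forall>\<^sub>F z in at_right 0. (\<Sum>j. c (j + k) * z ^ j) = D z"
    using eventually_at_right_real[of 0 1]
    by (rule eventually_mono) (use Dsums in \<open>auto simp: sums_iff\<close>)
  ultimately have Dlim: "(D \<longlongrightarrow> c k) (at_right 0)"
    by (rule Lim_transform_eventually)
  have tail: "\<bar>E x z - r x k\<bar> \<le> z / (1 - z)"
    if "0 < z" "z < 1" and r: "\<forall>j. 0 \<le> r x j \<and> r x j \<le> 1" for x z
  proof -
    have "summable (\<lambda>j. r x j * z ^ j)"
      by (rule summable_comparison_test'[of "\<lambda>j. z ^ j" 0]) (use that in \<open>auto intro!: mult_left_le_one_le simp: abs_mult\<close>)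
    then have "(\<lambda>j. r x (j + Suc k) * z ^ (j + Suc k)) sums
        ((\<Sum>j. r x j * z ^ j) - (\<Sum>j<Suc k. r x j * z ^ j))"
      by (rule sums_split_initial_segment[OF summable_sums])
    from sums_divide[OF this, of "z ^ k"]
    have 1: "(\<lambda>j. r x (j + Suc k) * z ^ j * z) sums (E x z - r x k)"
      using that by (simp add: E_def power_add field_simps)
    have 2: "(\<lambda>j. z ^ j * z) sums (1 / (1 - z) * z)"
      by (rule sums_mult2[OF geometric_sums]) (use that in auto)
    have "E x z - r x k \<le> 1 / (1 - z) * z"
      by (rule sums_le[OF _ 1 2]) (use that in \<open>auto intro!: mult_left_le_one_le simp: mult_right_mono\<close>)
    moreover have "0 \<le> E x z - r x k"
      by (rule sums_le[OF _ sums_zero 1]) (use that in auto)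
    ultimately show ?thesis by simp
  qed
  show ?case
  proof (rule tendstoI)
    fix e :: real assume e: "0 < e"
    have "((\<lambda>z::real. z / (1 - z)) \<longlongrightarrow> 0 / (1 - 0)) (at_right 0)"
      by (intro tendsto_intros) auto
    then have "\<forall>\<^sub>F z in at_right (0::real). z / (1 - z) < e / 3"
      using e by (intro order_tendstoD) auto
    moreover have "\<forall>\<^sub>F z in at_right 0. dist (D z) (c k) < e / 3"
      using tendstoD[OF Dlim, of "e / 3"] e by simp
    moreover have "\<forall>\<^sub>F z in at_right 0. z \<in> {0<..<1::real}"
      by (rule eventually_at_right_real) simp
    ultimately have "\<forall>\<^sub>F z in at_right 0. z / (1 - z) < e / 3 \<and> dist (D z) (c k) < e / 3 \<and> z \<in> {0<..<1::real}"
      by eventually_elim auto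
    then obtain z where z: "z / (1 - z) < e / 3" "dist (D z) (c k) < e / 3" "0 < z" "z < 1"
      using eventually_happens trivial_limit_at_right_real by force
    \<comment> \<open>With \<open>z\<close> fixed, the induction hypothesis controls the finitely
      many terms that were removed.\<close>
    have "((\<lambda>x. E x z) \<longlongrightarrow> D z) F"
      unfolding E_def D_def using less z by (intro tendsto_intros lim) auto
    then have "\<forall>\<^sub>F x in F. dist (E x z) (D z) < e / 3"
      using e by (intro tendstoD) auto
    with bd show "\<forall>\<^sub>F x in F. dist (r x k) (c k) < e"
    proof eventually_elim
      case (elim x)
      with tail[OF z(3,4) elim(1)] z(1,2) show ?case unfolding dist_real_def by linarith
    qed
  qed
qed

text \<open>The coefficients themselves serve as bounds in the M-test, which brings the endpoint 1
  into the domain.\<close>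

lemma continuous_on_power_series_unit:
  fixes c :: "nat \<Rightarrow> real"
  assumes "summable c" "\<And>k. 0 \<le> c k"
  shows "continuous_on {0..1} (\<lambda>x. \<Sum>k. c k * x ^ k)"
proof -
  have "uniform_limit {0..1} (\<lambda>n x. \<Sum>i<n. c i * x ^ i) (\<lambda>x. \<Sum>k. c k * x ^ k) sequentially"
    by (rule Weierstrass_m_test[where M = c])
      (use assms in \<open>auto simp: abs_mult power_le_one intro!: mult_left_le\<close>)
  then show ?thesis
    by (rule uniform_limit_theorem[rotated]) (auto intro!: always_eventually continuous_intros)
qed

section \<open>Probability generating functions on the unit interval\<close>

lemma sums_expectation_nat_pmf:
  fixes f :: "nat \<Rightarrow> real"
  assumes "\<And>k. \<bar>f k\<bar> \<le> B"
  shows "(\<lambda>k. pmf q k * f k) sums measure_pmf.expectation q f"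
proof -
  have "integrable (measure_pmf q) f"
    by (rule measure_pmf.integrable_const_bound[where B = B]) (use assms in auto)
  then have "integrable (count_space UNIV) (\<lambda>k. pmf q k * f k)"
    by (simp add: measure_pmf_eq_density integrable_density)
  then have "(\<lambda>k. pmf q k * f k) sums (\<integral>k. pmf q k * f k \<partial>count_space UNIV)"
    by (rule sums_integral_count_space_nat)
  then show ?thesis
    by (simp add: measure_pmf_eq_density integral_density)
qed

lemma progeny_gf_sums:
  assumes "\<bar>x\<bar> \<le> 1"
  shows "(\<lambda>k. pmf q k * x ^ k) sums progeny_gf q x"
  using sums_expectation_nat_pmf[of "\<lambda>k. x ^ k" 1 q] assms
  by (simp add: progeny_gf_def power_abs power_le_one sums_iff)

lemma progeny_gf_expectation:
  assumes "\<bar>x\<bar> \<le> 1"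
  shows "progeny_gf q x = measure_pmf.expectation q (\<lambda>k. x ^ k)"
  using sums_expectation_nat_pmf[of "\<lambda>k. x ^ k" 1 q] assms
  by (simp add: progeny_gf_def power_abs power_le_one sums_iff)

lemma pmf_sums_1: "pmf q sums (1::real)" for q :: "nat pmf"
  using sums_expectation_nat_pmf[of "\<lambda>k. 1" 1 q] by simp

lemma progeny_gf_0 [simp]: "progeny_gf q 0 = pmf q 0"
  using powser_sums_zero[of "pmf q"] by (simp add: progeny_gf_def sums_iff)

lemma progeny_gf_1 [simp]: "progeny_gf q 1 = 1"
  using pmf_sums_1[of q] by (simp add: progeny_gf_def sums_iff)

lemma continuous_on_progeny_gf: "continuous_on {0..1} (progeny_gf q)"
  unfolding progeny_gf_def[abs_def]
  by (rule continuous_on_power_series_unit) (use pmf_sums_1[of q] in \<open>auto simp: sums_iff\<close>)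

lemma progeny_gf_inject:
  assumes "\<And>z. 0 < z \<Longrightarrow> z < 1 \<Longrightarrow> progeny_gf r z = progeny_gf s z"
  shows "r = s"
proof (rule pmf_eqI)
  fix k
  have "((\<lambda>_. pmf r k) \<longlongrightarrow> pmf s k) (at_top :: nat filter)"
  proof (rule power_series_coeff_tendsto[where r = "\<lambda>_. pmf r" and G = "progeny_gf s"])
    show "((\<lambda>x. \<Sum>j. pmf r j * z ^ j) \<longlongrightarrow> progeny_gf s z) at_top" if "0 < z" "z < 1" for z
      using assms[OF that] by (simp add: progeny_gf_def)
  qed (auto intro!: progeny_gf_sums simp: pmf_le_1)
  then show "pmf r k = pmf s k" by (simp add: tendsto_const_iff)
qed

lemma pmf_of_sums:
  fixes c :: "nat \<Rightarrow> real"
  assumes "\<And>k. 0 \<le> c k" "c sums 1"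
  shows "\<exists>r. pmf r = c"
proof
  show "pmf (embed_pmf c) = c"
  proof (rule ext, rule pmf_embed_pmf)
    show "(\<integral>\<^sup>+ x. ennreal (c x) \<partial>count_space UNIV) = 1"
      using assms by (simp add: nn_integral_count_space_nat suminf_ennreal2 sums_iff)
  qed (use assms in auto)
qed

text \<open>A converse to Abel's theorem for nonnegative terms: every partial sum at 1 is bounded by
  \<open>l\<close>, and the power series never exceeds \<open>suminf c\<close>. It supplies the
  total mass of a limiting generating function.\<close>

lemma sums_1_of_power_series_limit:
  fixes c :: "nat \<Rightarrow> real"
  assumes c: "\<And>k. 0 \<le> c k"
    and G: "\<And>z. 0 < z \<Longrightarrow> z < 1 \<Longrightarrow> (\<lambda>k. c k * z ^ k) sums G z"
    and lim: "(G \<longlongrightarrow> l) (at_left 1)"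
  shows "c sums l"
proof -
  note ev = eventually_at_left_1_unit
  have part: "(\<Sum>k<n. c k) \<le> l" for n
  proof (rule tendsto_le[OF _ lim])
    have "((\<lambda>z. \<Sum>k<n. c k * z ^ k) \<longlongrightarrow> (\<Sum>k<n. c k * 1 ^ k)) (at_left 1)"
      by (intro tendsto_intros)
    then show "((\<lambda>z. \<Sum>k<n. c k * z ^ k) \<longlongrightarrow> (\<Sum>k<n. c k)) (at_left 1)" by simp
    show "\<forall>\<^sub>F z in at_left 1. (\<Sum>k<n. c k * z ^ k) \<le> G z"
      using ev
    proof eventually_elim
      case (elim z)
      with G[of z] c have "(\<Sum>k<n. c k * z ^ k) \<le> (\<Sum>k. c k * z ^ k)"
        by (intro sum_le_suminf) (auto simp: sums_iff)
      with elim G[of z] show ?case by (auto simp: sums_iff)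
    qed
  qed simp
  then have s: "summable c"
    by (intro summableI_nonneg_bounded[where x = l]) (use c in auto)
  have "suminf c \<le> l"
    using s part by (intro suminf_le_const) auto
  moreover have "l \<le> suminf c"
  proof (rule tendsto_upperbound[OF lim])
    show "\<forall>\<^sub>F z in at_left 1. G z \<le> suminf c"
      using ev
    proof eventually_elim
      case (elim z)
      then have "\<And>k. c k * z ^ k \<le> c k" using c by (intro mult_left_le) (auto simp: power_le_one)
      then show ?case using sums_le[OF _ G[of z] summable_sums[OF s]] elim by auto
    qed
  qed simp
  ultimately show ?thesis using s by (simp add: sums_iff)
qed

section \<open>Thinned offspring distributions\<close>

text \<open>The termwise series, rather than \<open>deriv\<close>, because under a finite mean it
  also has the right value at the endpoint 1, where a two-sided derivative need not exist.\<close>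

definition progeny_gf_deriv :: "nat pmf \<Rightarrow> real \<Rightarrow> real" where
  "progeny_gf_deriv q x = (\<Sum>n. diffs (pmf q) n * x ^ n)"

text \<open>\<open>survivors q x\<close> is the law of the number of children that remain when each child is erased
  with probability \<open>x\<close>. A vertex with a single remaining child is merged with it; conditionally on
  not being erased, a vertex of the merged tree then has \<open>j\<close> children with probability
  \<open>thinned q x j\<close>, where \<open>x\<close> is the probability that a vertex is erased.\<close>

definition survivors :: "nat pmf \<Rightarrow> real \<Rightarrow> nat pmf" where
  "survivors q x = bind_pmf q (\<lambda>k. binomial_pmf k (1 - x))"

definition thinned :: "nat pmf \<Rightarrow> real \<Rightarrow> nat \<Rightarrow> real" where
  "thinned q x j =
     (if j = 0 then progeny_gf q x - x else if j = 1 then 0 else pmf (survivors q x) j)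
       / ((1 - x) * (1 - progeny_gf_deriv q x))"

lemma has_derivative_progeny_gf:
  assumes "\<bar>x\<bar> < 1"
  shows "(progeny_gf q has_real_derivative progeny_gf_deriv q x) (at x)"
  unfolding progeny_gf_def[abs_def] progeny_gf_deriv_def
  by (rule termdiffs_strong[where K = 1]) (use assms pmf_sums_1[of q] in \<open>auto simp: sums_iff\<close>)

lemma pmf_survivors_sums:
  assumes "0 \<le> x" "x \<le> 1"
  shows "(\<lambda>k. pmf q k * (real (k choose j) * (1 - x) ^ j * x ^ (k - j))) sums pmf (survivors q x) j"
proof -
  have b: "pmf (binomial_pmf k (1 - x)) j = real (k choose j) * (1 - x) ^ j * x ^ (k - j)" for k
    using assms by simp
  have "(\<lambda>k. pmf q k * pmf (binomial_pmf k (1 - x)) j) sums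
      measure_pmf.expectation q (\<lambda>k. pmf (binomial_pmf k (1 - x)) j)"
    by (rule sums_expectation_nat_pmf[where B = 1]) (simp add: pmf_le_1)
  then show ?thesis
    by (simp only: b survivors_def pmf_bind)
qed

lemma progeny_gf_binomial:
  assumes "0 \<le> p" "p \<le> 1" "0 \<le> z" "z \<le> 1"
  shows "progeny_gf (binomial_pmf k p) z = (1 - p + p * z) ^ k"
proof -
  have "progeny_gf (binomial_pmf k p) z =
      (\<Sum>j\<le>k. real (k choose j) * (p * z) ^ j * (1 - p) ^ (k - j))"
    using assms
    by (subst progeny_gf_expectation) (auto simp: expectation_binomial_pmf' power_mult_distrib mult_ac)
  also have "\<dots> = (p * z + (1 - p)) ^ k"
    by (simp add: binomial_ring)
  finally show ?thesis by (simp add: add.commute)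
qed

lemma nn_integral_power_pmf:
  assumes "0 \<le> z" "z \<le> 1"
  shows "(\<integral>\<^sup>+k. ennreal (z ^ k) \<partial>measure_pmf q) = ennreal (progeny_gf q z)"
  using assms
  by (subst nn_integral_eq_integral)
    (auto simp: progeny_gf_expectation power_le_one intro!: measure_pmf.integrable_const_bound[where B = 1])

lemma progeny_gf_nonneg: "0 \<le> z \<Longrightarrow> z \<le> 1 \<Longrightarrow> 0 \<le> progeny_gf q z"
  by (auto simp: progeny_gf_expectation intro!: integral_nonneg)

text \<open>Averages the binomial generating function over \<open>q\<close>. Nonnegative integrals
  let the bind be unfolded without integrability conditions.\<close>

lemma progeny_gf_survivors:
  assumes x: "0 \<le> x" "x \<le> 1" and z: "0 \<le> z" "z \<le> 1"
  shows "progeny_gf (survivors q x) z = progeny_gf q (x + (1 - x) * z)"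
proof -
  have y: "0 \<le> x + (1 - x) * z" "x + (1 - x) * z \<le> 1"
    using assms mult_left_le[of z "1 - x"] by auto
  have "ennreal (progeny_gf (survivors q x) z) =
      (\<integral>\<^sup>+k. \<integral>\<^sup>+j. ennreal (z ^ j) \<partial>measure_pmf (binomial_pmf k (1 - x)) \<partial>measure_pmf q)"
    using z by (simp add: nn_integral_power_pmf[symmetric] survivors_def)
  also have "\<dots> = (\<integral>\<^sup>+k. ennreal ((x + (1 - x) * z) ^ k) \<partial>measure_pmf q)"
    using assms by (simp add: nn_integral_power_pmf progeny_gf_binomial)
  also have "\<dots> = ennreal (progeny_gf q (x + (1 - x) * z))"
    by (rule nn_integral_power_pmf[OF y])
  finally show ?thesis
    using y z by (simp add: progeny_gf_nonneg)
qed

text \<open>The trapezoidal rule overestimates the integral of the convex function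
  \<open>k * t ^ (k - 1)\<close> over \<open>t\<close> from \<open>x\<close> to 1.\<close>

lemma trapezoid_power_le:
  fixes x :: real
  assumes "0 \<le> x" "x \<le> 1"
  shows "2 * (1 - x ^ k) \<le> real k * ((1 - x) * (1 + x ^ (k - 1)))"
proof (cases k)
  case (Suc n)
  \<comment> \<open>The tangent to \<open>t ^ Suc n\<close> at \<open>x\<close> lies below the curve
    at \<open>t = 1\<close>. Multiplied by \<open>1 - x\<close>, this is exactly the increment in
    the induction that follows.\<close>
  have bern: "(real n + 1) * x ^ n - real n * x ^ Suc n \<le> 1" for n
  proof (induction n)
    case (Suc n)
    have "x ^ Suc n * (1 - x) \<le> 1 * (1 - x)"
      by (rule mult_right_mono) (use assms power_le_one[of x "Suc n"] in auto)
    moreover have "x * ((real n + 1) * x ^ n - real n * x ^ Suc n) \<le> x * 1"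
      by (rule mult_left_mono) (use assms Suc in auto)
    ultimately show ?case by (simp add: algebra_simps)
  qed simp
  have "2 * (1 - x ^ Suc n) \<le> (real n + 1) * ((1 - x) * (1 + x ^ n))" for n
  proof (induction n)
    case (Suc n)
    have "(1 - x) * ((real n + 1) * x ^ n - real n * x ^ Suc n) \<le> (1 - x) * 1"
      by (rule mult_left_mono) (use assms bern[of n] in auto)
    with Suc show ?case by (simp add: algebra_simps)
  qed (simp add: algebra_simps)
  then show ?thesis using Suc by (simp add: add.commute)
qed simp

section \<open>Offspring distributions of mean at most 1\<close>

locale offspring =
  fixes q :: "nat pmf" and m :: real
  assumes no_one: "pmf q 1 = 0"
    and mean: "(\<lambda>k. real k * pmf q k) sums m"
    and mean_le: "m \<le> 1"
begin

abbreviation "Q \<equiv> progeny_gf q"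
abbreviation "Q' \<equiv> progeny_gf_deriv q"

lemma diffs_sums: "diffs (pmf q) sums m"
  using mean sums_Suc_iff[of "\<lambda>k. real k * pmf q k" m] by (simp add: diffs_def[abs_def])

lemma diffs_nonneg: "0 \<le> diffs (pmf q) n"
  by (simp add: diffs_def)

lemma Q'_sums:
  assumes "0 \<le> x" "x \<le> 1"
  shows "(\<lambda>n. diffs (pmf q) n * x ^ n) sums Q' x"
  unfolding progeny_gf_deriv_def
proof (rule summable_sums, rule summable_comparison_test'[OF sums_summable[OF diffs_sums]])
  show "norm (diffs (pmf q) n * x ^ n) \<le> diffs (pmf q) n" for n
    using assms diffs_nonneg[of n] by (auto simp: abs_mult power_le_one intro!: mult_left_le)
qed

lemma Q'_sums_shift:
  assumes "0 \<le> x" "x \<le> 1"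
  shows "(\<lambda>k. pmf q k * (real k * x ^ (k - 1))) sums Q' x"
proof -
  have "(\<lambda>n. pmf q (Suc n) * (real (Suc n) * x ^ (Suc n - 1))) sums Q' x"
    using Q'_sums[OF assms] by (simp add: diffs_def mult_ac)
  then show ?thesis by (subst (asm) sums_Suc_iff) simp
qed

lemma mean_nonneg: "0 \<le> m"
  by (rule sums_le[OF _ sums_zero mean]) auto

text \<open>Since \<open>pmf q 1 = 0\<close>, the series has no constant term, and every other power
  of \<open>x\<close> is at most \<open>x\<close>. The factor \<open>x\<close> keeps
  \<open>Q'\<close> strictly below 1 inside the interval even if \<open>m = 1\<close>.\<close>

lemma Q'_le:
  assumes "0 \<le> x" "x \<le> 1"
  shows "Q' x \<le> m * x"
proof (rule sums_le[OF _ Q'_sums[OF assms] sums_mult2[OF diffs_sums]])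
  fix n
  show "diffs (pmf q) n * x ^ n \<le> diffs (pmf q) n * x"
  proof (cases n)
    case 0
    then show ?thesis using no_one by (simp add: diffs_def)
  next
    case (Suc k)
    then show ?thesis using assms
      by (intro mult_left_mono diffs_nonneg) (auto intro!: mult_left_le simp: power_le_one)
  qed
qed

lemma Q'_le_mean: "0 \<le> x \<Longrightarrow> x \<le> 1 \<Longrightarrow> Q' x \<le> m"
  using Q'_le[of x] mult_left_le[of x m] mean_nonneg by linarith

lemma Q'_less_1: "0 \<le> x \<Longrightarrow> x < 1 \<Longrightarrow> Q' x < 1"
  using Q'_le[of x] mult_left_le_one_le[of x m] mean_nonneg mean_le by linarith

lemma Q'_tendsto: "(Q' \<longlongrightarrow> m) (at_left 1)"
proof -
  have "continuous_on {0..1} Q'"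
    unfolding progeny_gf_deriv_def[abs_def]
    by (rule continuous_on_power_series_unit[OF sums_summable[OF diffs_sums] diffs_nonneg])
  moreover have "Q' 1 = m"
    using diffs_sums by (simp add: progeny_gf_deriv_def sums_iff)
  ultimately have "(Q' \<longlongrightarrow> m) (at 1 within {0..1})"
    by (auto simp: continuous_on_def)
  then show ?thesis
    by (rule tendsto_within_subset[THEN tendsto_mono[rotated]]) (auto simp: at_within_Icc_at_left)
qed

text \<open>The derivative \<open>Q' x - 1\<close> is negative. Strictness makes 1 the only zero of
  \<open>Q x - x\<close> on \<open>[0, 1]\<close>, and lets the size of this gap locate the erasure
  probability.\<close>

lemma gap_decreasing:
  assumes "0 \<le> x" "x < y" "y \<le> 1"
  shows "Q y - y < Q x - x"
proof (rule DERIV_neg_imp_decreasing_open[OF assms(2)])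
  fix t assume t: "x < t" "t < y"
  show "\<exists>d. ((\<lambda>x. Q x - x) has_real_derivative d) (at t) \<and> d < 0"
    using t assms Q'_less_1[of t]
    by (intro exI[of _ "Q' t - 1"] conjI derivative_intros has_derivative_progeny_gf) auto
next
  show "continuous_on {x..y} (\<lambda>x. Q x - x)"
    by (intro continuous_intros continuous_on_subset[OF continuous_on_progeny_gf]) (use assms in auto)
qed

lemma gap_pos: "0 \<le> x \<Longrightarrow> x < 1 \<Longrightarrow> 0 < Q x - x"
  using gap_decreasing[of x 1] by simp

text \<open>\<open>Q x - m * x\<close> decreases because \<open>Q'\<close> is at most
  \<open>m\<close>. In the subcritical case the bound is linear in \<open>1 - x\<close> with
  positive slope.\<close>

lemma gap_ge:
  assumes "0 \<le> x" "x \<le> 1"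
  shows "(1 - m) * (1 - x) \<le> Q x - x"
proof -
  have "Q 1 - m * 1 \<le> Q x - m * x"
  proof (rule DERIV_nonpos_imp_decreasing_open[OF assms(2)])
    fix t assume t: "x < t" "t < 1"
    show "\<exists>d. ((\<lambda>x. Q x - m * x) has_real_derivative d) (at t) \<and> d \<le> 0"
      using t assms Q'_le_mean[of t]
      by (intro exI[of _ "Q' t - m"] conjI) (auto intro!: derivative_eq_intros has_derivative_progeny_gf)
  next
    show "continuous_on {x..1} (\<lambda>x. Q x - m * x)"
      by (intro continuous_intros continuous_on_subset[OF continuous_on_progeny_gf]) (use assms in auto)
  qed
  then show ?thesis by (simp add: algebra_simps)
qed

lemma pmf_survivors_0:
  assumes "0 \<le> x" "x \<le> 1"
  shows "pmf (survivors q x) 0 = Q x"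
  using pmf_survivors_sums[OF assms, of q 0] progeny_gf_sums[of x q] assms
  by (auto simp: sums_iff)

lemma pmf_survivors_1:
  assumes "0 \<le> x" "x \<le> 1"
  shows "pmf (survivors q x) 1 = (1 - x) * Q' x"
  using pmf_survivors_sums[OF assms, of q 1] sums_mult[OF Q'_sums_shift[OF assms], of "1 - x"]
  by (auto simp: sums_iff mult_ac)

text \<open>Survivors have the generating function \<open>Q y\<close>. Up to the denominator,
  \<open>thinned\<close> lowers its constant coefficient by \<open>x\<close> and deletes the linear
  one. Since \<open>y\<close> is affine in \<open>z\<close>, the removed part equals
  \<open>y\<close> minus the denominator times \<open>z\<close>.\<close>

lemma thinned_sums:
  assumes x: "0 \<le> x" "x < 1" and z: "0 \<le> z" "z \<le> 1"
  defines "y \<equiv> x + (1 - x) * z"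
  shows "(\<lambda>j. thinned q x j * z ^ j) sums (z + (Q y - y) / ((1 - x) * (1 - Q' x)))"
proof -
  define D where "D = (1 - x) * (1 - Q' x)"
  have D: "D > 0" using x Q'_less_1[of x] by (simp add: D_def)
  have N: "(\<lambda>j. pmf (survivors q x) j * z ^ j) sums Q y"
    using progeny_gf_sums[of z "survivors q x"] progeny_gf_survivors[of x z q] x z by (simp add: y_def)
  have "(\<lambda>j. pmf (survivors q x) j * z ^ j - (if j = 0 then x else 0)
      - (if j = 1 then (1 - x) * Q' x * z else 0)) sums (Q y - x - (1 - x) * Q' x * z)"
    by (intro sums_diff N sums_single)
  also have "(\<lambda>j. pmf (survivors q x) j * z ^ j - (if j = 0 then x else 0)
      - (if j = 1 then (1 - x) * Q' x * z else 0)) = (\<lambda>j. thinned q x j * z ^ j * D)"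
  proof
    fix j show "pmf (survivors q x) j * z ^ j - (if j = 0 then x else 0)
      - (if j = 1 then (1 - x) * Q' x * z else 0) = thinned q x j * z ^ j * D"
      using D x pmf_survivors_0[of x] pmf_survivors_1[of x]
      by (auto simp: thinned_def D_def[symmetric])
  qed
  finally have "(\<lambda>j. thinned q x j * z ^ j * D / D) sums ((Q y - x - (1 - x) * Q' x * z) / D)"
    by (rule sums_divide)
  moreover have "(Q y - x - (1 - x) * Q' x * z) / D = z + (Q y - y) / D"
    using D by (simp add: field_simps) (simp add: D_def y_def algebra_simps)
  ultimately show ?thesis using D by (simp add: D_def[symmetric])
qed

lemma thinned_nonneg: "0 \<le> x \<Longrightarrow> x < 1 \<Longrightarrow> 0 \<le> thinned q x j"
  using Q'_less_1[of x] gap_pos[of x] by (auto simp: thinned_def intro!: divide_nonneg_nonneg)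

lemma thinned_le_1:
  assumes "0 \<le> x" "x < 1"
  shows "thinned q x j \<le> 1"
proof -
  have s: "thinned q x sums 1" using thinned_sums[OF assms, of 1] by simp
  have "sum (thinned q x) {j} \<le> suminf (thinned q x)"
    using s assms by (intro sum_le_suminf) (auto simp: sums_iff thinned_nonneg)
  then show ?thesis using s by (simp add: sums_iff)
qed

text \<open>Below mean 1 branching disappears in the limit: \<open>gap_ge\<close> bounds the
  numerator from below, and \<open>1 - Q' x\<close> tends to \<open>1 - m\<close>.\<close>

lemma thinned_0_tendsto:
  assumes "m < 1"
  shows "((\<lambda>x. thinned q x 0) \<longlongrightarrow> 1) (at_left 1)"
proof (rule tendsto_sandwich)
  note ev = eventually_at_left_1_unit
  then show "\<forall>\<^sub>F x in at_left 1. thinned q x 0 \<le> 1"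
    by eventually_elim (auto intro: thinned_le_1)
  show "\<forall>\<^sub>F x in at_left 1. (1 - m) / (1 - Q' x) \<le> thinned q x 0"
    using ev
  proof eventually_elim
    case (elim x)
    then have "1 - Q' x > 0" using Q'_less_1[of x] by auto
    with elim gap_ge[of x] show ?case
      by (simp add: thinned_def divide_simps mult_ac)
  qed
  have "((\<lambda>x. (1 - m) / (1 - Q' x)) \<longlongrightarrow> (1 - m) / (1 - m)) (at_left 1)"
    by (intro tendsto_intros Q'_tendsto) (use assms in auto)
  then show "((\<lambda>x. (1 - m) / (1 - Q' x)) \<longlongrightarrow> 1) (at_left 1)"
    using assms by simp
qed auto

end

section \<open>Regular variation in the critical case\<close>

text \<open>The Taylor coefficients at 0 of
  \<open>z + \<Lambda> * (1 - z) powr (1 / \<Lambda>)\<close>, from the generalised binomial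
  series.\<close>

definition igw_coeff :: "real \<Rightarrow> nat \<Rightarrow> real" where
  "igw_coeff \<Lambda> j = (if j = 1 then 1 else 0) + \<Lambda> * ((1 / \<Lambda> gchoose j) * (- 1) ^ j)"

lemma igw_coeff_sums:
  assumes "0 < z" "z < 1"
  shows "(\<lambda>j. igw_coeff \<Lambda> j * z ^ j) sums (z + \<Lambda> * (1 - z) powr (1 / \<Lambda>))"
proof -
  have "(\<lambda>j. (1 / \<Lambda> gchoose j) * (- z) ^ j) sums (1 - z) powr (1 / \<Lambda>)"
    using gen_binomial_real[of "- z" "1 / \<Lambda>"] assms by simp
  from sums_add[OF sums_single[of 1 "\<lambda>_. z"] sums_mult[OF this, of \<Lambda>]]
  have "(\<lambda>j. (if j = 1 then z else 0) + \<Lambda> * ((1 / \<Lambda> gchoose j) * (- z) ^ j))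
      sums (z + \<Lambda> * (1 - z) powr (1 / \<Lambda>))" .
  moreover have "(\<lambda>j. igw_coeff \<Lambda> j * z ^ j) =
      (\<lambda>j. (if j = 1 then z else 0) + \<Lambda> * ((1 / \<Lambda> gchoose j) * (- z) ^ j))"
    by (auto simp: igw_coeff_def power_minus[of z] algebra_simps)
  ultimately show ?thesis by simp
qed

text \<open>The definite description needs a witness and uniqueness: nonnegative coefficients
  summing to 1 form a distribution, and \<open>progeny_gf_inject\<close> excludes any other.\<close>

lemma pmf_igw_offspring:
  assumes "0 < \<Lambda>" and nonneg: "\<And>j. 0 \<le> igw_coeff \<Lambda> j"
  shows "pmf (igw_offspring \<Lambda>) = igw_coeff \<Lambda>"
proof -
  have "((\<lambda>z. (1 - z) powr (1 / \<Lambda>)) \<longlongrightarrow> 0) (at_left 1)"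
  proof (rule tendsto_zero_powrI[OF _ tendsto_const])
    show "((\<lambda>z. 1 - z) \<longlongrightarrow> 0) (at_left (1::real))"
      by (rule tendsto_eq_intros refl | simp)+
    show "\<forall>\<^sub>F z in at_left 1. 0 \<le> 1 - (z::real)"
      using eventually_at_left_1_unit by (rule eventually_mono) auto
  qed (use assms in auto)
  then have "((\<lambda>z. z + \<Lambda> * (1 - z) powr (1 / \<Lambda>)) \<longlongrightarrow> 1 + \<Lambda> * 0) (at_left 1)"
    by (intro tendsto_intros)
  then have "((\<lambda>z. z + \<Lambda> * (1 - z) powr (1 / \<Lambda>)) \<longlongrightarrow> 1) (at_left 1)"
    by simp
  then have "igw_coeff \<Lambda> sums 1"
    by (rule sums_1_of_power_series_limit[OF nonneg igw_coeff_sums, rotated 2])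
  then obtain r where r: "pmf r = igw_coeff \<Lambda>"
    using pmf_of_sums nonneg by blast
  have gf: "progeny_gf r z = z + \<Lambda> * (1 - z) powr (1 / \<Lambda>)" if "0 < z" "z < 1" for z
    using igw_coeff_sums[OF that, of \<Lambda>] r by (simp add: progeny_gf_def sums_iff)
  have "igw_offspring \<Lambda> = r"
    unfolding igw_offspring_def
  proof (rule the_equality)
    show "\<forall>z\<in>{0..1}. progeny_gf r z = z + \<Lambda> * (1 - z) powr (1 / \<Lambda>)"
    proof
      fix z :: real assume "z \<in> {0..1}"
      then consider "z = 0" | "0 < z" "z < 1" | "z = 1" by fastforce
      then show "progeny_gf r z = z + \<Lambda> * (1 - z) powr (1 / \<Lambda>)"
        by cases (auto simp: gf r igw_coeff_def)
    qed
  next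
    fix s assume "\<forall>z\<in>{0..1}. progeny_gf s z = z + \<Lambda> * (1 - z) powr (1 / \<Lambda>)"
    then show "s = r" by (intro progeny_gf_inject) (auto simp: gf)
  qed
  with r show ?thesis by simp
qed

locale critical_offspring = offspring q 1 for q
begin

text \<open>Averages \<open>trapezoid_power_le\<close> over the offspring number, with mean 1 as the
  slope of \<open>Q\<close> at 1. It keeps the limit \<open>\<Lambda>\<close> away from 0.\<close>

lemma gap_ge_half:
  assumes "0 \<le> x" "x \<le> 1"
  shows "(1 - x) * (1 - Q' x) \<le> 2 * (Q x - x)"
proof -
  have "(\<lambda>k. 2 * (pmf q k * x ^ k) - 2 * pmf q k + (1 - x) * (real k * pmf q k)
      + (1 - x) * (pmf q k * (real k * x ^ (k - 1)))) sums
      (2 * Q x - 2 * 1 + (1 - x) * 1 + (1 - x) * Q' x)"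
    by (intro sums_add sums_diff sums_mult progeny_gf_sums pmf_sums_1 mean Q'_sums_shift)
      (use assms in auto)
  then have "0 \<le> 2 * Q x - 2 * 1 + (1 - x) * 1 + (1 - x) * Q' x"
  proof (rule sums_le[OF _ sums_zero, rotated])
    fix k
    have "0 \<le> pmf q k * (real k * ((1 - x) * (1 + x ^ (k - 1))) - 2 * (1 - x ^ k))"
      using trapezoid_power_le[OF assms, of k] by simp
    then show "0 \<le> 2 * (pmf q k * x ^ k) - 2 * pmf q k + (1 - x) * (real k * pmf q k)
        + (1 - x) * (pmf q k * (real k * x ^ (k - 1)))"
      by (simp add: algebra_simps)
  qed
  then show ?thesis by (simp add: algebra_simps)
qed

text \<open>The coefficients of \<open>g_fun\<close> are iterated tail sums of \<open>pmf q\<close>,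
  and multiplication by \<open>(1 - x)\<^sup>2\<close> undoes both summations. Criticality and
  \<open>no_one\<close> settle the first two coefficients.\<close>

lemma gap_eq_g_fun:
  assumes "0 \<le> x" "x < 1"
  shows "Q x - x = (1 - x)\<^sup>2 * g_fun q x"
proof -
  define t where "t n k = (if n + 1 \<le> k then (real k - real n - 1) * pmf q k else 0)" for n k
  define a where "a n = (\<Sum>k. t n k)" for n
  have t: "0 \<le> t n k \<and> t n k \<le> real k * pmf q k" for n k
    by (auto simp: t_def intro!: mult_nonneg_nonneg mult_right_mono)
  have a: "t n sums a n" for n
    unfolding a_def
    by (rule summable_sums, rule summable_comparison_test'[OF sums_summable[OF mean]]) (use t in auto)
  have bd: "0 \<le> a n" "a n \<le> 1" for n
    using sums_le[OF _ sums_zero a[of n]] sums_le[OF _ a[of n] mean] t by auto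
  \<comment> \<open>The second difference in \<open>n\<close> of \<open>k - n - 1\<close>, cut off
    at 0, vanishes except at \<open>k = n + 2\<close>.\<close>
  have diff2: "a n - 2 * a (n + 1) + a (n + 2) = pmf q (n + 2)" for n
  proof -
    have "(\<lambda>k. t n k - 2 * t (n + 1) k + t (n + 2) k) sums (a n - 2 * a (n + 1) + a (n + 2))"
      by (intro sums_add sums_diff sums_mult a)
    moreover have "(\<lambda>k. t n k - 2 * t (n + 1) k + t (n + 2) k) = (\<lambda>k. if k = n + 2 then pmf q k else 0)"
    proof
      fix k
      consider "k \<le> n" | "k = n + 1" | "k = n + 2" | "k \<ge> n + 3" by linarith
      then show "t n k - 2 * t (n + 1) k + t (n + 2) k = (if k = n + 2 then pmf q k else 0)"
        by cases (auto simp: t_def algebra_simps)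
    qed
    ultimately show ?thesis
      using sums_single[of "n + 2" "pmf q"] sums_unique2 by fastforce
  qed
  have a0: "a 0 = pmf q 0"
  proof -
    \<comment> \<open>At \<open>k = 0\<close> the uncut weight \<open>k - 1\<close> would contribute
      \<open>- pmf q 0\<close>; the last summand cancels this.\<close>
    have "(\<lambda>k. real k * pmf q k - pmf q k + (if k = 0 then pmf q k else 0)) sums (1 - 1 + pmf q 0)"
      by (intro sums_add sums_diff mean pmf_sums_1 sums_single)
    also have "(\<lambda>k. real k * pmf q k - pmf q k + (if k = 0 then pmf q k else 0)) = t 0"
      by (auto simp: t_def algebra_simps)
    finally show ?thesis using a[of 0] sums_unique2 by fastforce
  qed
  have a1: "a 1 = 2 * pmf q 0 - 1"
  proof -
    have "(\<lambda>k. real k * pmf q k - 2 * pmf q k + 2 * (if k = 0 then pmf q k else 0)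
        + (if k = 1 then pmf q k else 0)) sums (1 - 2 * 1 + 2 * pmf q 0 + pmf q 1)"
      by (intro sums_add sums_diff sums_mult mean pmf_sums_1 sums_single)
    also have "(\<lambda>k. real k * pmf q k - 2 * pmf q k + 2 * (if k = 0 then pmf q k else 0)
        + (if k = 1 then pmf q k else 0)) = t 1"
    proof
      fix k :: nat
      consider "k = 0" | "k = 1" | "k \<ge> 2" by linarith
      then show "real k * pmf q k - 2 * pmf q k + 2 * (if k = 0 then pmf q k else 0)
        + (if k = 1 then pmf q k else 0) = t 1 k"
        by cases (auto simp: t_def algebra_simps)
    qed
    finally show ?thesis using a[of 1] sums_unique2 no_one by fastforce
  qed
  have "summable (\<lambda>n. a n * x ^ n)"
    by (rule summable_comparison_test'[of "\<lambda>n. x ^ n" 0])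
      (use assms bd in \<open>auto simp: abs_mult intro!: mult_left_le_one_le\<close>)
  then have g: "(\<lambda>n. a n * x ^ n) sums g_fun q x"
    by (simp add: g_fun_def a_def t_def summable_sums)
  then have "(\<lambda>n. a (n + 1) * x ^ (n + 1)) sums (g_fun q x - a 0)"
    using sums_split_initial_segment[OF g, of 1] by simp
  moreover have "(\<lambda>n. a (n + 2) * x ^ (n + 2)) sums (g_fun q x - a 0 - a 1 * x)"
    using sums_split_initial_segment[OF g, of 2] by (simp add: numeral_2_eq_2 algebra_simps)
  ultimately have "(\<lambda>n. x\<^sup>2 * (a n * x ^ n) - 2 * x * (a (n + 1) * x ^ (n + 1)) + a (n + 2) * x ^ (n + 2))
      sums (x\<^sup>2 * g_fun q x - 2 * x * (g_fun q x - a 0) + (g_fun q x - a 0 - a 1 * x))"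
    by (intro sums_add sums_diff sums_mult g)
  moreover have "x\<^sup>2 * (a n * x ^ n) - 2 * x * (a (n + 1) * x ^ (n + 1)) + a (n + 2) * x ^ (n + 2)
      = pmf q (n + 2) * x ^ (n + 2)" for n
    unfolding diff2[of n, symmetric] by (simp add: power2_eq_square algebra_simps)
  moreover have "(\<lambda>n. pmf q (n + 2) * x ^ (n + 2)) sums (Q x - pmf q 0)"
    using sums_split_initial_segment[OF progeny_gf_sums[of x q], of 2] assms no_one
    by (simp add: numeral_2_eq_2)
  ultimately have "x\<^sup>2 * g_fun q x - 2 * x * (g_fun q x - a 0) + (g_fun q x - a 0 - a 1 * x) = Q x - pmf q 0"
    using sums_unique2 by fastforce
  then show ?thesis
    unfolding a0 a1 by (simp add: power2_eq_square algebra_simps)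
qed

end

locale regular_critical_offspring = critical_offspring +
  fixes \<Lambda> :: real
  assumes ratio: "((\<lambda>x. (Q x - x) / ((1 - x) * (1 - Q' x))) \<longlongrightarrow> \<Lambda>) (at_left 1)"
begin

lemma half_le: "1 / 2 \<le> \<Lambda>"
proof (rule tendsto_lowerbound[OF ratio])
  show "\<forall>\<^sub>F x in at_left 1. 1 / 2 \<le> (Q x - x) / ((1 - x) * (1 - Q' x))"
    using eventually_at_left_1_unit
  proof eventually_elim
    case (elim x)
    then have "0 < (1 - x) * (1 - Q' x)" using Q'_less_1[of x] by simp
    with gap_ge_half[of x] elim show ?case by (simp add: divide_simps)
  qed
qed simp

lemma ratio_inverse: "((\<lambda>x. (1 - x) * (1 - Q' x) / (Q x - x)) \<longlongrightarrow> 1 / \<Lambda>) (at_left 1)"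
  using tendsto_divide[OF tendsto_const[of 1] ratio] half_le by simp

text \<open>By \<open>gap_eq_g_fun\<close> the numerator is
  \<open>ln (Q x - x) - 2 * ln (1 - x)\<close>. In l'Hopital's rule the quotient of derivatives is 2
  minus the reciprocal of the ratio in the hypothesis.\<close>

lemma ln_g_fun_tendsto: "((\<lambda>x. ln (g_fun q x) / (- ln (1 - x))) \<longlongrightarrow> 2 - 1 / \<Lambda>) (at_left 1)"
proof -
  have "((\<lambda>x. (ln (Q x - x) - 2 * ln (1 - x)) / (- ln (1 - x))) \<longlongrightarrow> 2 - 1 / \<Lambda>) (at_left 1)"
  proof (rule lhopital_left_at_top)
    show "LIM x at_left (1::real). - ln (1 - x) :> at_top"
      by real_asymp
    show "\<forall>\<^sub>F x in at_left 1. 1 / (1 - x) \<noteq> (0::real)"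
      using eventually_at_left_1_unit by eventually_elim auto
    show "\<forall>\<^sub>F x in at_left (1::real). ((\<lambda>x. - ln (1 - x)) has_real_derivative 1 / (1 - x)) (at x)"
      using eventually_at_left_1_unit by eventually_elim (auto intro!: derivative_eq_intros)
    show "\<forall>\<^sub>F x in at_left 1. ((\<lambda>x. ln (Q x - x) - 2 * ln (1 - x)) has_real_derivative
        (Q' x - 1) / (Q x - x) + 2 / (1 - x)) (at x)"
      using eventually_at_left_1_unit
    proof eventually_elim
      case (elim x)
      then have "Q x - x > 0" using gap_pos[of x] by auto
      with elim show ?case
        by (auto intro!: derivative_eq_intros has_derivative_progeny_gf)
    qed
    have "((\<lambda>x. 2 - (1 - x) * (1 - Q' x) / (Q x - x)) \<longlongrightarrow> 2 - 1 / \<Lambda>) (at_left 1)"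
      by (intro tendsto_intros ratio_inverse)
    then show "((\<lambda>x. ((Q' x - 1) / (Q x - x) + 2 / (1 - x)) / (1 / (1 - x))) \<longlongrightarrow> 2 - 1 / \<Lambda>) (at_left 1)"
    proof (rule Lim_transform_eventually)
      show "\<forall>\<^sub>F x in at_left 1. 2 - (1 - x) * (1 - Q' x) / (Q x - x) =
          ((Q' x - 1) / (Q x - x) + 2 / (1 - x)) / (1 / (1 - x))"
        using eventually_at_left_1_unit
      proof eventually_elim
        case (elim x)
        then have "Q x - x \<noteq> 0" "1 - x \<noteq> 0" using gap_pos[of x] by auto
        moreover have "2 - u * w / h = (- w / h + 2 / u) / (1 / u)" if "h \<noteq> 0" "u \<noteq> 0" for u w h :: real
          using that by (simp add: field_simps)
        from this[of "Q x - x" "1 - x" "1 - Q' x"] calculation show ?case by simp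
      qed
    qed
  qed
  then show ?thesis
  proof (rule Lim_transform_eventually)
    show "\<forall>\<^sub>F x in at_left 1. (ln (Q x - x) - 2 * ln (1 - x)) / (- ln (1 - x)) =
        ln (g_fun q x) / (- ln (1 - x))"
      using eventually_at_left_1_unit
    proof eventually_elim
      case (elim x)
      then have "g_fun q x > 0"
        using gap_pos[of x] gap_eq_g_fun[of x] by (auto simp: zero_less_mult_iff)
      with elim have "ln (Q x - x) - 2 * ln (1 - x) = ln (g_fun q x)"
        by (simp add: gap_eq_g_fun ln_mult ln_realpow)
      then show ?case by simp
    qed
  qed
qed

text \<open>The hypothesis says that the logarithmic derivative of \<open>Q x - x\<close> is asymptotic to
  that of \<open>(1 - x) powr (1 / \<Lambda>)\<close>; hence \<open>Q x - x\<close> is regularly varying at 1.\<close>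

lemma gap_regularly_varying:
  assumes s: "0 < s" "s < 1"
  shows "((\<lambda>x. (Q (1 - (1 - x) * s) - (1 - (1 - x) * s)) / (Q x - x)) \<longlongrightarrow> s powr (1 / \<Lambda>)) (at_left 1)"
proof -
  have between: "x < 1 - (1 - x) * s" "1 - (1 - x) * s < 1" if "x < 1" for x
  proof -
    have "(1 - x) * s < 1 - x" using that s by simp
    then show "x < 1 - (1 - x) * s" by linarith
    show "1 - (1 - x) * s < 1" using that s by simp
  qed
  \<comment> \<open>The logarithm of \<open>(Q x - x) / (1 - x) powr (1 / \<Lambda>)\<close>; its
    change from \<open>x\<close> to \<open>1 - (1 - x) * s\<close> has to vanish in the
    limit.\<close>
  define f where "f x = ln (Q x - x) - ln (1 - x) / \<Lambda>" for x
  define f' where "f' x = (1 / \<Lambda> - (1 - x) * (1 - Q' x) / (Q x - x)) / (1 - x)" for x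
  have f': "(f has_real_derivative f' x) (at x)" if "0 < x" "x < 1" for x
  proof -
    have "Q x - x > 0" using gap_pos[of x] that by auto
    then have "(f has_real_derivative (Q' x - 1) / (Q x - x) + 1 / (1 - x) / \<Lambda>) (at x)"
      unfolding f_def using that half_le
      by (auto intro!: derivative_eq_intros has_derivative_progeny_gf)
    moreover have "(Q' x - 1) / (Q x - x) + 1 / (1 - x) / \<Lambda> = f' x"
      using \<open>Q x - x > 0\<close> that half_le by (simp add: f'_def field_simps)
    ultimately show ?thesis by simp
  qed
  have f'_lim: "((\<lambda>x. (1 - x) * f' x) \<longlongrightarrow> 0) (at_left 1)"
  proof (rule Lim_transform_eventually)
    have "((\<lambda>x. 1 / \<Lambda> - (1 - x) * (1 - Q' x) / (Q x - x)) \<longlongrightarrow> 1 / \<Lambda> - 1 / \<Lambda>) (at_left 1)"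
      by (intro tendsto_intros ratio_inverse)
    then show "((\<lambda>x. 1 / \<Lambda> - (1 - x) * (1 - Q' x) / (Q x - x)) \<longlongrightarrow> 0) (at_left 1)" by simp
    show "\<forall>\<^sub>F x in at_left 1. 1 / \<Lambda> - (1 - x) * (1 - Q' x) / (Q x - x) = (1 - x) * f' x"
      using eventually_at_left_1_unit by eventually_elim (auto simp: f'_def)
  qed
  have lim: "((\<lambda>x. f (1 - (1 - x) * s) - f x) \<longlongrightarrow> 0) (at_left 1)"
  proof (rule tendstoI)
    fix e :: real assume "0 < e"
    \<comment> \<open>The interval from \<open>x\<close> to \<open>y\<close> below has length at
      most \<open>(1 - t) / s\<close> for each of its points \<open>t\<close>; the factor
      \<open>s\<close> in the tolerance compensates for this.\<close>
    then have "\<forall>\<^sub>F x in at_left 1. dist ((1 - x) * f' x) 0 < e * s"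
      using s by (intro tendstoD[OF f'_lim]) simp
    then obtain b where b: "b < 1" "\<And>x. b < x \<Longrightarrow> x < 1 \<Longrightarrow> \<bar>(1 - x) * f' x\<bar> < e * s"
      by (subst (asm) eventually_at_left[of 0]) auto
    have "\<forall>\<^sub>F x in at_left 1. x \<in> {max b 0<..<1}"
      by (rule eventually_at_left_real) (use b in auto)
    then show "\<forall>\<^sub>F x in at_left 1. dist (f (1 - (1 - x) * s) - f x) 0 < e"
    proof eventually_elim
      case (elim x)
      define y where "y = 1 - (1 - x) * s"
      have y: "x < y" "y < 1"
        using between[of x] elim by (auto simp: y_def)
      obtain t where t: "x < t" "t < y" "f y - f x = (y - x) * f' t"
        using MVT2[OF y(1), of f f'] f' elim y by auto
      have "(y - x) * s \<le> 1 - y"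
        using elim s by (simp add: y_def algebra_simps)
      then have "(y - x) * s \<le> 1 - t" using t by linarith
      then have "\<bar>f y - f x\<bar> * s \<le> (1 - t) * \<bar>f' t\<bar>"
        using t y mult_right_mono[of "(y - x) * s" "1 - t" "\<bar>f' t\<bar>"] by (simp add: abs_mult mult_ac)
      also have "\<dots> < e * s"
        using b(2)[of t] t y elim by (simp add: abs_mult)
      finally show ?case using s by (simp add: y_def)
    qed
  qed
  have "((\<lambda>x. s powr (1 / \<Lambda>) * exp (f (1 - (1 - x) * s) - f x)) \<longlongrightarrow> s powr (1 / \<Lambda>) * exp 0) (at_left 1)"
    by (intro tendsto_intros lim)
  then have "((\<lambda>x. s powr (1 / \<Lambda>) * exp (f (1 - (1 - x) * s) - f x)) \<longlongrightarrow> s powr (1 / \<Lambda>)) (at_left 1)"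
    by simp
  then show ?thesis
  proof (rule Lim_transform_eventually)
    show "\<forall>\<^sub>F x in at_left 1. s powr (1 / \<Lambda>) * exp (f (1 - (1 - x) * s) - f x) =
        (Q (1 - (1 - x) * s) - (1 - (1 - x) * s)) / (Q x - x)"
      using eventually_at_left_1_unit
    proof eventually_elim
      case (elim x)
      define y where "y = 1 - (1 - x) * s"
      have y: "x < y" "y < 1"
        using between[of x] elim by (auto simp: y_def)
      have "Q x - x > 0" "Q y - y > 0" using gap_pos elim y by auto
      moreover have "f y - f x = ln (Q y - y) - ln (Q x - x) - ln s / \<Lambda>"
        using s elim by (simp add: f_def y_def ln_mult add_divide_distrib)
      ultimately show ?case
        using s by (simp add: y_def[symmetric] powr_def exp_diff)
    qed
  qed
qed

text \<open>With \<open>s = 1 - z\<close> the argument \<open>y\<close> in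
  \<open>thinned_sums\<close> is \<open>1 - (1 - x) * s\<close>. The quotient there is the ratio in
  the hypothesis times the quotient in \<open>gap_regularly_varying\<close>.\<close>

lemma thinned_gf_tendsto:
  assumes z: "0 < z" "z < 1"
  shows "((\<lambda>x. \<Sum>j. thinned q x j * z ^ j) \<longlongrightarrow> z + \<Lambda> * (1 - z) powr (1 / \<Lambda>)) (at_left 1)"
proof -
  have "((\<lambda>x. z + (Q x - x) / ((1 - x) * (1 - Q' x)) *
        ((Q (1 - (1 - x) * (1 - z)) - (1 - (1 - x) * (1 - z))) / (Q x - x)))
      \<longlongrightarrow> z + \<Lambda> * (1 - z) powr (1 / \<Lambda>)) (at_left 1)"
    by (intro tendsto_intros ratio gap_regularly_varying) (use z in auto)
  then show ?thesis
  proof (rule Lim_transform_eventually)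
    show "\<forall>\<^sub>F x in at_left 1. z + (Q x - x) / ((1 - x) * (1 - Q' x)) *
        ((Q (1 - (1 - x) * (1 - z)) - (1 - (1 - x) * (1 - z))) / (Q x - x)) =
        (\<Sum>j. thinned q x j * z ^ j)"
      using eventually_at_left_1_unit
    proof eventually_elim
      case (elim x)
      have "1 - (1 - x) * (1 - z) = x + (1 - x) * z" by (simp add: algebra_simps)
      with elim z thinned_sums[of x z] gap_pos[of x] show ?case by (simp add: sums_iff)
    qed
  qed
qed

lemma thinned_tendsto: "((\<lambda>x. thinned q x j) \<longlongrightarrow> pmf (igw_offspring \<Lambda>) j) (at_left 1)"
proof -
  have lim: "((\<lambda>x. thinned q x j) \<longlongrightarrow> igw_coeff \<Lambda> j) (at_left 1)" for j
  proof (rule power_series_coeff_tendsto)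
    show "\<forall>\<^sub>F x in at_left 1. \<forall>j. 0 \<le> thinned q x j \<and> thinned q x j \<le> 1"
      using eventually_at_left_1_unit by eventually_elim (auto intro: thinned_nonneg thinned_le_1)
  qed (rule thinned_gf_tendsto igw_coeff_sums; assumption)+
  \<comment> \<open>Nonnegativity is inherited from the approximating probabilities rather than read
    off the binomial formula; it makes \<open>igw_offspring \<Lambda>\<close> well defined.\<close>
  have "0 \<le> igw_coeff \<Lambda> j" for j
    by (rule tendsto_lowerbound[OF lim])
      (use eventually_at_left_1_unit in \<open>auto elim!: eventually_mono intro: thinned_nonneg\<close>)
  then show ?thesis using lim half_le pmf_igw_offspring[of \<Lambda>] by simp
qed

end

section \<open>Galton--Watson forests and the colouring\<close>

definition add_option :: "'a option \<Rightarrow> 'a multiset \<Rightarrow> 'a multiset" where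
  "add_option a D = (case a of None \<Rightarrow> D | Some t \<Rightarrow> add_mset t D)"

lemma add_option_simps [simp]: "add_option None D = D" "add_option (Some t) D = add_mset t D"
  by (simp_all add: add_option_def)

text \<open>If \<open>f\<close> is a probability mass function, then \<open>sample_weight f D\<close> is the probability that
  \<open>size D\<close> independent samples form the multiset \<open>D\<close>; the recursion is on the first sample.\<close>

function sample_weight :: "('a \<Rightarrow> real) \<Rightarrow> 'a multiset \<Rightarrow> real" where
  "sample_weight f D =
     (if D = {#} then 1 else \<Sum>t\<in>set_mset D. f t * sample_weight f (D - {#t#}))"
  by pat_completeness auto
termination
  by (relation "Wellfounded.measure (size \<circ> snd)") (auto simp: size_Diff1_less)

declare sample_weight.simps [simp del]

lemma sample_weight_empty [simp]: "sample_weight f {#} = 1"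
  by (simp add: sample_weight.simps)

lemma sample_weight_single [simp]: "sample_weight f {#t#} = f t"
  by (simp add: sample_weight.simps)

text \<open>Homogeneity, used to pass from the masses of a coloured branch to those conditioned on
  survival.\<close>

lemma sample_weight_scale:
  "sample_weight (\<lambda>t. c * f t) D = c ^ size D * sample_weight f D"
proof (induction "size D" arbitrary: D)
  case (Suc n)
  have "sample_weight (\<lambda>t. c * f t) D =
      (\<Sum>t\<in>set_mset D. c * f t * sample_weight (\<lambda>t. c * f t) (D - {#t#}))"
    using Suc(2) by (subst sample_weight.simps) auto
  also have "\<dots> = (\<Sum>t\<in>set_mset D. c ^ size D * (f t * sample_weight f (D - {#t#})))"
  proof (rule sum.cong)
    fix t assume "t \<in># D"
    then have "n = size (D - {#t#})" using Suc(2) by (simp add: size_Diff_singleton)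
    then have "sample_weight (\<lambda>t. c * f t) (D - {#t#}) = c ^ n * sample_weight f (D - {#t#})"
      using Suc(1)[of "D - {#t#}"] by simp
    then show "c * f t * sample_weight (\<lambda>t. c * f t) (D - {#t#}) =
        c ^ size D * (f t * sample_weight f (D - {#t#}))"
      using Suc(2)[symmetric] by simp
  qed simp
  also have "\<dots> = c ^ size D * sample_weight f D"
    using Suc(2) by (subst (2) sample_weight.simps) (auto simp: sum_distrib_left)
  finally show ?case .
qed simp

lemma tendsto_sample_weight:
  assumes "\<And>t. t \<in># D \<Longrightarrow> ((\<lambda>x. f x t) \<longlongrightarrow> g t) F"
  shows "((\<lambda>x. sample_weight (f x) D) \<longlongrightarrow> sample_weight g D) F"
  using assms
proof (induction "size D" arbitrary: D)
  case (Suc n)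
  have "((\<lambda>x. \<Sum>t\<in>set_mset D. f x t * sample_weight (f x) (D - {#t#})) \<longlongrightarrow>
      (\<Sum>t\<in>set_mset D. g t * sample_weight g (D - {#t#}))) F"
  proof (intro tendsto_intros)
    fix t assume t: "t \<in># D"
    then show "((\<lambda>x. f x t) \<longlongrightarrow> g t) F" by (rule Suc(3))
    show "((\<lambda>x. sample_weight (f x) (D - {#t#})) \<longlongrightarrow> sample_weight g (D - {#t#})) F"
      using t Suc(2) by (intro Suc(1)) (auto simp: size_Diff_singleton dest: in_diffD intro: Suc(3))
  qed
  then show ?case using Suc(2) by (auto simp: sample_weight.simps[of _ D])
qed simp

text \<open>Among \<open>n\<close> independent samples the dropped positions are chosen binomially
  and the others form \<open>D\<close>. Only the recursion of \<open>F\<close> is assumed, so that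
  plain and coloured forests are both instances.\<close>

lemma spmf_sum_independent_option:
  fixes A :: "'a option spmf"
  assumes zero: "F 0 = return_spmf {#}"
    and step: "\<And>n. F (Suc n) = bind_spmf A (\<lambda>a. map_spmf (add_option a) (F n))"
  shows "spmf (F n) D =
    real (n choose size D) * spmf A None ^ (n - size D) * sample_weight (\<lambda>t. spmf A (Some t)) D"
proof (induction n arbitrary: D)
  case 0
  show ?case
    by (cases "D = {#}") (auto simp: zero nonempty_has_size)
next
  case (Suc n)
  define v where "v = spmf A None"
  define f where "f = (\<lambda>t. spmf A (Some t))"
  \<comment> \<open>Cases for the first sample: it is dropped, or it is one of the distinct elements
    of \<open>D\<close>. Indicators of single points turn the integral over \<open>a\<close> into a
    finite sum.\<close>
  have split: "spmf (map_spmf (add_option a) (F n)) D = spmf (F n) D * indicator {None} a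
      + (\<Sum>t\<in>set_mset D. spmf (F n) (D - {#t#}) * indicator {Some t} a)" for a
  proof (cases a)
    case None
    have "add_option (None :: 'a option) = (\<lambda>D. D)" by auto
    then show ?thesis by (simp add: None)
  next
    case (Some t)
    have "(\<Sum>s\<in>set_mset D. spmf (F n) (D - {#s#}) * indicator {Some s} (Some t)) =
        (\<Sum>s\<in>set_mset D. if s = t then spmf (F n) (D - {#t#}) else 0)"
      by (rule sum.cong) (auto simp: indicator_def)
    moreover have "add_option (Some t) -` {D} = (if t \<in># D then {D - {#t#}} else {})"
      by (auto dest: multi_member_split)
    ultimately show ?thesis
      by (simp add: Some spmf_map spmf_conv_measure_spmf[symmetric])
  qed
  have rec: "spmf (F (Suc n)) D = v * spmf (F n) D + (\<Sum>t\<in>set_mset D. f t * spmf (F n) (D - {#t#}))"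
  proof -
    have int: "integrable (measure_spmf A) (\<lambda>a. c * indicator {y} a)" for c :: real and y
      by (rule measure_spmf.integrable_const_bound[where B = "\<bar>c\<bar>"]) (auto simp: indicator_def)
    have val: "(\<integral>a. c * indicator {y} a \<partial>measure_spmf A) = spmf A y * c" for c :: real and y
      by (simp add: spmf_conv_measure_spmf)
    show ?thesis
      unfolding step spmf_bind split
      by (simp only: Bochner_Integration.integral_add[OF int Bochner_Integration.integrable_sum[OF int]]
          Bochner_Integration.integral_sum[OF int] val v_def f_def)
  qed
  show ?case
  proof (cases "D = {#}")
    case True
    then show ?thesis using rec Suc.IH[of "{#}"] by (simp add: v_def)
  next
    case False
    then obtain j where j: "size D = Suc j" by (metis nonempty_has_size gr0_implies_Suc)
    have "(\<Sum>t\<in>set_mset D. f t * spmf (F n) (D - {#t#})) =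
        (\<Sum>t\<in>set_mset D. real (n choose j) * v ^ (n - j) * (f t * sample_weight f (D - {#t#})))"
      by (rule sum.cong) (auto simp: Suc.IH size_Diff_singleton j v_def f_def)
    also have "\<dots> = real (n choose j) * v ^ (n - j) * sample_weight f D"
      using False by (subst (2) sample_weight.simps) (simp add: sum_distrib_left)
    finally have "spmf (F (Suc n)) D = v * spmf (F n) D + real (n choose j) * v ^ (n - j) * sample_weight f D"
      using rec by simp
    \<comment> \<open>Together with the term for a kept first sample this gives Pascal's rule. If
      \<open>n < Suc j\<close>, the binomial coefficient is 0 and hides the truncated
      exponent.\<close>
    also have "v * spmf (F n) D = real (n choose Suc j) * v ^ (n - j) * sample_weight f D"
    proof (cases "n \<ge> Suc j")
      case True
      then have "v ^ (n - j) = v * v ^ (n - Suc j)" by (metis Suc_diff_le diff_Suc_Suc power_Suc)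
      then show ?thesis by (simp add: Suc.IH j v_def f_def)
    next
      case False
      then show ?thesis by (simp add: Suc.IH j binomial_eq_0)
    qed
    finally show ?thesis by (simp add: j v_def f_def algebra_simps)
  qed
qed

definition branch :: "nat pmf \<Rightarrow> tree spmf" where
  "branch q = bind_spmf (spmf_of_pmf q) (\<lambda>k. map_spmf Node (gw_forest q k))"

lemma gw_forest_0 [simp]: "gw_forest q 0 = return_spmf {#}"
  by (subst gw_forest.simps) simp

lemma gw_forest_Suc: "gw_forest q (Suc n) = bind_spmf (branch q) (\<lambda>t. map_spmf (add_mset t) (gw_forest q n))"
  by (subst gw_forest.simps)
    (simp add: branch_def map_spmf_conv_bind_spmf del: bind_spmf_of_pmf)

lemma size_gw_forest: "F \<in> set_spmf (gw_forest q n) \<Longrightarrow> size F = n"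
  by (induction n arbitrary: F) (auto simp: gw_forest_Suc set_bind_spmf bind_UNION)

lemma spmf_gw_forest:
  "spmf (gw_forest q n) D = (if size D = n then sample_weight (spmf (branch q)) D else 0)"
proof -
  have "spmf (gw_forest q n) D = real (n choose size D) *
      spmf (map_spmf Some (branch q)) None ^ (n - size D) *
      sample_weight (\<lambda>t. spmf (map_spmf Some (branch q)) (Some t)) D"
    by (rule spmf_sum_independent_option)
      (auto simp: gw_forest_Suc bind_map_spmf o_def add_option_def[abs_def])
  \<comment> \<open>Nothing is dropped, so the power of 0 excludes \<open>size D < n\<close>, while
    \<open>0 ^ 0 = 1\<close> at equality.\<close>
  moreover have "spmf (map_spmf Some (branch q)) None = 0"
    by (rule spmf_map_outside) auto
  moreover have "spmf (map_spmf Some (branch q)) (Some t) = spmf (branch q) t" for t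
    by (rule spmf_map_inj') simp
  ultimately show ?thesis
    by (cases "size D" n rule: linorder_cases) (auto simp: power_0_left)
qed

text \<open>A recursion on the tree that determines the law from the offspring probabilities;
  \<open>pruned_eq\<close> below has the same shape.\<close>

lemma spmf_branch:
  "spmf (branch q) s = pmf q (size (subtrees s)) * sample_weight (spmf (branch q)) (subtrees s)"
proof -
  have "spmf (map_spmf Node (gw_forest q k)) s = spmf (gw_forest q k) (subtrees s)" for k
    using spmf_map_inj'[of Node "gw_forest q k" "subtrees s"] by (simp add: inj_def)
  then have "(\<lambda>k. spmf (map_spmf Node (gw_forest q k)) s) =
      (\<lambda>k. sample_weight (spmf (branch q)) (subtrees s) * indicator {size (subtrees s)} k)"
    by (auto simp: spmf_gw_forest)
  moreover have "spmf (branch q) s =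
      measure_pmf.expectation q (\<lambda>k. spmf (map_spmf Node (gw_forest q k)) s)"
    by (simp add: branch_def spmf_bind del: bind_spmf_of_pmf)
  ultimately show ?thesis by (simp add: pmf.rep_eq mult.commute)
qed

lemma weight_gw_forest: "weight_spmf (gw_forest q n) = weight_spmf (branch q) ^ n"
proof (induction n)
  case (Suc n)
  then show ?case
    by (simp add: gw_forest_Suc weight_bind_spmf o_def weight_spmf_def[of "branch q"] mult.commute)
qed simp

text \<open>The mass of \<open>branch q\<close> is the extinction probability, since infinite
  families are exactly the missing mass.\<close>

lemma weight_branch_fixed_point: "weight_spmf (branch q) = progeny_gf q (weight_spmf (branch q))"
proof -
  have "weight_spmf (branch q) =
      weight_spmf (bind_spmf (spmf_of_pmf q) (\<lambda>k. map_spmf Node (gw_forest q k)))"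
    by (simp only: branch_def)
  also have "\<dots> = measure_pmf.expectation q (\<lambda>k. weight_spmf (branch q) ^ k)"
    by (simp add: weight_bind_spmf o_def weight_gw_forest del: bind_spmf_of_pmf)
  also have "\<dots> = progeny_gf q (weight_spmf (branch q))"
    by (rule progeny_gf_expectation[symmetric]) (simp add: weight_spmf_le_1 weight_spmf_nonneg)
  finally show ?thesis .
qed

section \<open>Colouring of branches and forests\<close>

definition color_branch :: "real \<Rightarrow> tree \<Rightarrow> tree option pmf" where
  "color_branch p t =
     map_pmf (\<lambda>M. if has_selected M then Some (merge_edges (minimal_subtree M)) else None)
       (select_leaves p t)"

definition color_forest :: "real \<Rightarrow> tree multiset \<Rightarrow> tree multiset pmf" where
  "color_forest p F =
     map_pmf (\<lambda>Ms. image_mset (\<lambda>M. merge_edges (minimal_subtree M)) (filter_mset has_selected Ms))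
       (indep_mset (image_mset (select_leaves p) F))"

lemma color_forest_empty [simp]: "color_forest p {#} = return_pmf {#}"
  by (simp add: color_forest_def)

lemma color_forest_add_mset:
  "color_forest p (add_mset t F) =
     bind_pmf (color_branch p t) (\<lambda>a. map_pmf (add_option a) (color_forest p F))"
  by (auto simp: color_forest_def color_branch_def map_bind_pmf bind_map_pmf pmf.map_comp o_def
      intro!: bind_pmf_cong pmf.map_cong)

lemma has_selected_MNode: "has_selected (MNode b C) \<longleftrightarrow> b \<or> (\<exists>t\<in>#C. has_selected t)"
  by (auto elim: has_selected.cases intro: has_selected.intros)

lemma color_branch_leaf:
  "color_branch p (Node {#}) = map_pmf (\<lambda>b. if b then Some (Node {#}) else None) (bernoulli_pmf (1 - p))"
  by (auto simp: color_branch_def pmf.map_comp o_def has_selected_MNode merge_vertex_def intro!: pmf.map_cong)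

lemma color_branch_Node:
  assumes "C \<noteq> {#}"
  shows "color_branch p (Node C) =
    map_pmf (\<lambda>D. if D = {#} then None else Some (merge_vertex D)) (color_forest p C)"
  using assms
  by (auto simp: color_branch_def color_forest_def pmf.map_comp o_def has_selected_MNode
      image_mset.compositionality filter_mset_eq_conv intro!: pmf.map_cong)

lemma leaf_coloring_conv: "leaf_coloring p T = map_pmf Node (color_forest p (subtrees T))"
  by (auto simp: leaf_coloring_def select_leaves_root_def color_forest_def merge_edges_root_def
      pmf.map_comp o_def image_mset.compositionality intro!: pmf.map_cong)

section \<open>The law of the coloured tree\<close>

definition colored_branch :: "real \<Rightarrow> nat pmf \<Rightarrow> tree option spmf" where
  "colored_branch p q = bind_spmf (branch q) (\<lambda>t. spmf_of_pmf (color_branch p t))"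

definition colored_forest :: "real \<Rightarrow> nat pmf \<Rightarrow> nat \<Rightarrow> tree multiset spmf" where
  "colored_forest p q n = bind_spmf (gw_forest q n) (\<lambda>F. spmf_of_pmf (color_forest p F))"

lemma colored_forest_0 [simp]: "colored_forest p q 0 = return_spmf {#}"
  by (simp add: colored_forest_def)

lemma spmf_of_pmf_bind_pmf:
  "spmf_of_pmf (bind_pmf M f) = bind_spmf (spmf_of_pmf M) (\<lambda>x. spmf_of_pmf (f x))"
  unfolding bind_spmf_of_pmf by (simp add: spmf_of_pmf_def map_bind_pmf)

text \<open>The sampling of the other trees commutes with the colouring of the first, so each tree
  can be grouped with its own colouring.\<close>

lemma colored_forest_Suc:
  "colored_forest p q (Suc n) =
     bind_spmf (colored_branch p q) (\<lambda>a. map_spmf (add_option a) (colored_forest p q n))"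
proof -
  have "colored_forest p q (Suc n) =
      bind_spmf (branch q) (\<lambda>t. bind_spmf (gw_forest q n) (\<lambda>F.
        bind_spmf (spmf_of_pmf (color_branch p t)) (\<lambda>a.
          spmf_of_pmf (map_pmf (add_option a) (color_forest p F)))))"
    by (simp add: colored_forest_def gw_forest_Suc bind_map_spmf o_def color_forest_add_mset
        spmf_of_pmf_bind_pmf del: bind_spmf_of_pmf)
  also have "\<dots> = bind_spmf (branch q) (\<lambda>t. bind_spmf (spmf_of_pmf (color_branch p t)) (\<lambda>a.
        bind_spmf (gw_forest q n) (\<lambda>F. spmf_of_pmf (map_pmf (add_option a) (color_forest p F)))))"
    by (subst bind_commute_spmf) (rule refl)
  also have "\<dots> = bind_spmf (colored_branch p q) (\<lambda>a. map_spmf (add_option a) (colored_forest p q n))"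
    by (simp add: colored_branch_def colored_forest_def map_spmf_bind_spmf o_def del: bind_spmf_of_pmf)
  finally show ?thesis .
qed

lemma spmf_colored_forest:
  "spmf (colored_forest p q n) D =
     real (n choose size D) * spmf (colored_branch p q) None ^ (n - size D) *
     sample_weight (\<lambda>t. spmf (colored_branch p q) (Some t)) D"
  by (rule spmf_sum_independent_option) (simp_all add: colored_forest_Suc)

definition prune :: "tree multiset \<Rightarrow> tree option" where
  "prune D = (if D = {#} then None else Some (merge_vertex D))"

text \<open>The case \<open>k = 0\<close> stands apart: a childless vertex is a leaf and survives if
  selected, whereas a vertex that loses all its children is erased.\<close>

lemma colored_branch_conv:
  "colored_branch p q = bind_spmf (spmf_of_pmf q) (\<lambda>k.
     if k = 0 then spmf_of_pmf (color_branch p (Node {#}))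
     else map_spmf prune (colored_forest p q k))"
proof -
  have "bind_spmf (gw_forest q k) (\<lambda>C. spmf_of_pmf (color_branch p (Node C))) =
      (if k = 0 then spmf_of_pmf (color_branch p (Node {#}))
       else map_spmf prune (colored_forest p q k))" for k
    by (auto simp: colored_forest_def map_spmf_bind_spmf o_def color_branch_Node prune_def[abs_def]
        nonempty_has_size
        dest!: size_gw_forest intro!: bind_spmf_cong)
  then show ?thesis
    by (simp add: colored_branch_def branch_def bind_map_spmf o_def del: bind_spmf_of_pmf)
qed

lemma spmf_colored_branch_sums:
  "(\<lambda>k. pmf q k * (if k = 0 then pmf (color_branch p (Node {#})) y
       else spmf (map_spmf prune (colored_forest p q k)) y)) sums spmf (colored_branch p q) y"
proof -
  have "spmf (colored_branch p q) y = measure_pmf.expectation q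
      (\<lambda>k. if k = 0 then pmf (color_branch p (Node {#})) y
       else spmf (map_spmf prune (colored_forest p q k)) y)"
    unfolding colored_branch_conv spmf_bind
    by (auto intro!: Bochner_Integration.integral_cong)
  then show ?thesis
    by (simp only:) (rule sums_expectation_nat_pmf[where B = 1], auto simp: pmf_le_1)
qed

lemma pmf_color_branch_leaf:
  assumes "0 \<le> p" "p \<le> 1"
  shows "pmf (color_branch p (Node {#})) None = p"
    "pmf (color_branch p (Node {#})) (Some s) = (if s = Node {#} then 1 - p else 0)"
proof -
  have "(\<lambda>b. if b then Some (Node {#}) else None) -` {None :: tree option} = {False}"
    "(\<lambda>b. if b then Some (Node {#}) else None) -` {Some s} = (if s = Node {#} then {True} else {})"
    by (auto split: if_splits)
  then show "pmf (color_branch p (Node {#})) None = p"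
    "pmf (color_branch p (Node {#})) (Some s) = (if s = Node {#} then 1 - p else 0)"
    using assms by (simp_all add: color_branch_leaf pmf_map measure_pmf_single)
qed

lemma spmf_prune_None: "spmf (map_spmf prune M) None = spmf M {#}"
proof -
  have "prune -` {None} = {{#}}" by (auto simp: prune_def split: if_splits)
  then show ?thesis by (simp add: spmf_map spmf_conv_measure_spmf[symmetric])
qed

text \<open>Two multisets of remaining children yield \<open>s\<close>: \<open>s\<close> alone,
  whose parent is merged away, and the subtrees of \<open>s\<close> if there are at least two. Their
  sizes differ, so the masses add.\<close>

lemma spmf_prune_Some:
  "spmf (map_spmf prune M) (Some s) =
     spmf M {#s#} + (if 2 \<le> size (subtrees s) then spmf M (subtrees s) else 0)"
proof -
  have single: "(size D = 1) = (\<exists>t. D = {#t#})" for D :: "tree multiset"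
    by (metis size_1_singleton_mset size_single)
  have merge: "merge_vertex D = s \<longleftrightarrow> D = {#s#} \<or> size D \<noteq> 1 \<and> D = subtrees s" for D
    unfolding merge_vertex_def single by (cases s) auto
  have "prune -` {Some s} = {{#s#}} \<union> (if 2 \<le> size (subtrees s) then {subtrees s} else {})"
    (is "?L = ?R")
  proof (rule set_eqI)
    fix D :: "tree multiset"
    have two: "2 \<le> size D \<longleftrightarrow> D \<noteq> {#} \<and> size D \<noteq> 1"
      by (cases "size D" rule: nat.exhaust) (auto simp: nonempty_has_size)
    have "D \<in> ?L \<longleftrightarrow> D \<noteq> {#} \<and> merge_vertex D = s"
      by (simp add: prune_def)
    also have "\<dots> \<longleftrightarrow> D = {#s#} \<or> 2 \<le> size D \<and> D = subtrees s"
      unfolding merge two by auto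
    also have "\<dots> \<longleftrightarrow> D \<in> ?R"
      by (cases "2 \<le> size (subtrees s)") auto
    finally show "D \<in> ?L \<longleftrightarrow> D \<in> ?R" .
  qed
  moreover have "measure (measure_spmf M) ?R =
      spmf M {#s#} + (if 2 \<le> size (subtrees s) then spmf M (subtrees s) else 0)"
  proof (cases "2 \<le> size (subtrees s)")
    case True
    then have "{#s#} \<noteq> subtrees s" by (metis numeral_le_one_iff semiring_norm(69) size_single)
    with True show ?thesis
      by (subst measure_spmf.finite_measure_Union) (auto simp: spmf_conv_measure_spmf[symmetric])
  qed (simp add: spmf_conv_measure_spmf[symmetric])
  ultimately show ?thesis by (simp add: spmf_map)
qed

lemma colored_law_GW:
  "colored_law p (GW q) = map_spmf (\<lambda>a. Node (add_option a {#})) (colored_branch p q)"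
proof -
  have "colored_law p (GW q) = map_spmf Node (colored_forest p q (Suc 0))"
    by (simp add: colored_law_def GW_def bind_map_spmf o_def leaf_coloring_conv colored_forest_def
        map_spmf_bind_spmf)
  then show ?thesis
    by (simp add: colored_forest_Suc map_spmf_bind_spmf o_def map_spmf_conv_bind_spmf[of _ "colored_branch p q"])
qed

section \<open>Erasure probability and the conditioned branch\<close>

context offspring
begin

lemma pmf_0_pos: "0 < pmf q 0"
  using gap_pos[of 0] by simp

text \<open>The mass is a fixed point of \<open>Q\<close> in \<open>[0, 1]\<close>, and
  \<open>gap_pos\<close> leaves only 1.\<close>

lemma weight_branch: "weight_spmf (branch q) = 1"
  using gap_pos[of "weight_spmf (branch q)"] weight_branch_fixed_point[of q]
    weight_spmf_le_1[of "branch q"] weight_spmf_nonneg[of "branch q"]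
  by fastforce

lemma weight_colored_branch: "weight_spmf (colored_branch p q) = 1"
  using weight_branch by (simp add: colored_branch_def weight_bind_spmf o_def)

abbreviation "erased p \<equiv> spmf (colored_branch p q) None"

definition pruned :: "real \<Rightarrow> tree \<Rightarrow> real" where
  "pruned p s = spmf (colored_branch p q) (Some s) / (1 - erased p)"

text \<open>Only a childless vertex deviates from the rule that all children must be erased: it is
  erased with probability \<open>p\<close>, while \<open>erased p ^ 0 = 1\<close>. The right-hand
  side is this deviation, weighted by \<open>pmf q 0\<close>.\<close>

lemma gap_erased:
  assumes "0 \<le> p" "p \<le> 1"
  shows "Q (erased p) - erased p = pmf q 0 * (1 - p)"
proof -
  have "(\<lambda>k. pmf q k * erased p ^ k - (if k = 0 then pmf q 0 * (1 - p) else 0)) sums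
      (Q (erased p) - pmf q 0 * (1 - p))"
    by (intro sums_diff progeny_gf_sums sums_single[of 0 "\<lambda>_. pmf q 0 * (1 - p)"]) (simp add: pmf_le_1)
  moreover have "(\<lambda>k. pmf q k * erased p ^ k - (if k = 0 then pmf q 0 * (1 - p) else 0)) =
      (\<lambda>k. pmf q k * (if k = 0 then pmf (color_branch p (Node {#})) None
       else spmf (map_spmf prune (colored_forest p q k)) None))"
    using assms
    by (auto simp: pmf_color_branch_leaf spmf_prune_None spmf_colored_forest algebra_simps)
  ultimately show ?thesis
    using spmf_colored_branch_sums[of q p None] sums_unique2 by fastforce
qed

lemma erased_less_1:
  assumes "0 \<le> p" "p < 1"
  shows "erased p < 1"
proof -
  have "erased p \<noteq> 1"
  proof
    assume *: "erased p = 1"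
    show False using gap_erased[of p] assms pmf_0_pos unfolding * by simp
  qed
  then show ?thesis using pmf_le_1[of "colored_branch p q" "Some None"] by simp
qed

text \<open>The gap at \<open>erased p\<close> eventually falls below the gap at any fixed
  \<open>b < 1\<close>, and strict monotonicity then puts \<open>erased p\<close> above
  \<open>b\<close>. The target filter \<open>at_left 1\<close> allows limits in \<open>x\<close> to
  be composed with \<open>erased\<close>.\<close>

lemma erased_tendsto: "filterlim erased (at_left 1) (at_left 1)"
  unfolding filterlim_at
proof
  note ev = eventually_at_left_1_unit
  then show "\<forall>\<^sub>F p in at_left 1. erased p \<in> {..<1} \<and> erased p \<noteq> 1"
  proof eventually_elim
    case (elim p)
    then show ?case using erased_less_1[of p] by auto
  qed
  show "(erased \<longlongrightarrow> 1) (at_left 1)"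
  proof (rule order_tendstoI)
    fix a :: real assume "1 < a"
    then show "\<forall>\<^sub>F p in at_left 1. erased p < a"
      by (intro always_eventually) (meson le_less_trans pmf_le_1)
  next
    fix a :: real assume a: "a < 1"
    \<comment> \<open>The gap lemmas apply from 0 upwards, so a negative \<open>a\<close> is
      replaced by 0.\<close>
    define b where "b = max a 0"
    have b: "0 \<le> b" "b < 1" "a \<le> b" using a by (auto simp: b_def)
    have "((\<lambda>p. pmf q 0 * (1 - p)) \<longlongrightarrow> pmf q 0 * (1 - 1)) (at_left 1)"
      by (intro tendsto_intros)
    then have "\<forall>\<^sub>F p in at_left 1. pmf q 0 * (1 - p) < Q b - b"
      by (rule order_tendstoD) (use gap_pos[of b] b in auto)
    with ev show "\<forall>\<^sub>F p in at_left 1. a < erased p"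
    proof eventually_elim
      case (elim p)
      then have "Q (erased p) - erased p < Q b - b"
        using gap_erased[of p] by auto
      then have "b < erased p"
        using gap_decreasing[of "erased p" b] b by (cases "erased p" b rule: linorder_cases) auto
      with b show ?case by simp
    qed
  qed
qed

text \<open>Conditionally on not being erased, a coloured branch is again a Galton--Watson branch, with
  offspring weights \<open>thinned q (erased p)\<close>.\<close>

lemma pruned_eq:
  assumes p: "0 \<le> p" "p < 1"
  shows "pruned p s = thinned q (erased p) (size (subtrees s)) * sample_weight (pruned p) (subtrees s)"
proof -
  define v where "v = erased p"
  define j where "j = size (subtrees s)"
  define a where "a t = spmf (colored_branch p q) (Some t)" for t
  define W where "W = (if 2 \<le> j then sample_weight a (subtrees s) else 0)"
  have v: "0 \<le> v" "v < 1" using erased_less_1[OF p] by (auto simp: v_def)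
  have a_def': "spmf (colored_branch p q) (Some t) = a t" for t by (simp add: a_def)
  have leaf: "s = Node {#} \<longleftrightarrow> j = 0" by (cases s) (auto simp: j_def)
  have Wv: "W = (if 2 \<le> j then (1 - v) ^ j * sample_weight (pruned p) (subtrees s) else 0)"
  proof -
    have "a = (\<lambda>t. (1 - v) * pruned p t)"
      using v by (auto simp: a_def pruned_def v_def)
    then have "sample_weight a (subtrees s) = (1 - v) ^ j * sample_weight (pruned p) (subtrees s)"
      unfolding j_def by (simp only: sample_weight_scale)
    then show ?thesis by (simp add: W_def)
  qed
  have Nsums: "(\<lambda>k. pmf q k * (real (k choose j) * v ^ (k - j)) * (1 - v) ^ j) sums pmf (survivors q v) j"
    using pmf_survivors_sums[of v q j] v by (simp add: mult_ac)
  have N: "(\<lambda>k. pmf q k * (real (k choose j) * v ^ (k - j)) * W) sums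
      (if 2 \<le> j then pmf (survivors q v) j * sample_weight (pruned p) (subtrees s) else 0)"
    using sums_mult2[OF Nsums, of "sample_weight (pruned p) (subtrees s)"]
    by (auto simp: Wv mult_ac)
  \<comment> \<open>One summand for each way to obtain \<open>s\<close>: a selected leaf, a single
    surviving child that is already \<open>s\<close>, or at least two surviving children that are
    the subtrees of \<open>s\<close>.\<close>
  have "(\<lambda>k. (if k = 0 then (if j = 0 then pmf q 0 * (1 - p) else 0) else 0)
      + pmf q k * (real k * v ^ (k - 1)) * a s
      + pmf q k * (real (k choose j) * v ^ (k - j)) * W) sums
      ((if j = 0 then pmf q 0 * (1 - p) else 0) + Q' v * a s
        + (if 2 \<le> j then pmf (survivors q v) j * sample_weight (pruned p) (subtrees s) else 0))"
    by (intro sums_add N sums_mult2 Q'_sums_shift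
        sums_single[of 0 "\<lambda>_. if j = 0 then pmf q 0 * (1 - p) else 0"]) (use v in auto)
  also have "(\<lambda>k. (if k = 0 then (if j = 0 then pmf q 0 * (1 - p) else 0) else 0)
      + pmf q k * (real k * v ^ (k - 1)) * a s
      + pmf q k * (real (k choose j) * v ^ (k - j)) * W) =
      (\<lambda>k. pmf q k * (if k = 0 then pmf (color_branch p (Node {#})) (Some s)
       else spmf (map_spmf prune (colored_forest p q k)) (Some s)))"
    using p
    by (auto simp: pmf_color_branch_leaf spmf_prune_Some spmf_colored_forest leaf W_def
        j_def[symmetric] a_def' v_def[symmetric] algebra_simps)
  finally have "a s = (if j = 0 then pmf q 0 * (1 - p) else 0) + Q' v * a s
        + (if 2 \<le> j then pmf (survivors q v) j * sample_weight (pruned p) (subtrees s) else 0)"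
    using spmf_colored_branch_sums[of q p "Some s"] sums_unique2 unfolding a_def by fastforce
  \<comment> \<open>A single surviving child reproduces \<open>s\<close>, so \<open>a s\<close>
    occurs on both sides; solving for it accounts for chains of merged vertices of any
    length.\<close>
  then have "a s * (1 - Q' v) = (if j = 0 then pmf q 0 * (1 - p) else 0)
        + (if 2 \<le> j then pmf (survivors q v) j * sample_weight (pruned p) (subtrees s) else 0)"
    by (simp add: right_diff_distrib mult.commute[of "a s"])
  \<comment> \<open>\<open>gap_erased\<close> removes the explicit \<open>p\<close>: the leaf term
    too becomes a function of \<open>v\<close> alone.\<close>
  also have "\<dots> = (if j = 0 then Q v - v else 0)
        + (if 2 \<le> j then pmf (survivors q v) j * sample_weight (pruned p) (subtrees s) else 0)"
    using gap_erased[of p] p by (simp add: v_def)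
  also have "\<dots> = thinned q v j * ((1 - v) * (1 - Q' v)) * sample_weight (pruned p) (subtrees s)"
    using v Q'_less_1[of v] leaf by (auto simp: thinned_def)
  finally have "a s * (1 - Q' v) = thinned q v j * sample_weight (pruned p) (subtrees s) * (1 - v) * (1 - Q' v)"
    by (simp add: mult_ac)
  then have "a s = thinned q v j * sample_weight (pruned p) (subtrees s) * (1 - v)"
    using v Q'_less_1[of v] by simp
  then show ?thesis
    using v by (simp add: pruned_def a_def v_def[symmetric] j_def[symmetric])
qed

lemma measure_colored_nonempty:
  "measure (measure_spmf (colored_law p (GW q))) {t. t \<noteq> empty_tree} = 1 - erased p"
proof -
  have "(\<lambda>a. Node (add_option a {#})) -` {t. t \<noteq> empty_tree} = UNIV - {None}"
    by (auto simp: empty_tree_def add_option_def split: option.splits)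
  then have "measure (measure_spmf (colored_law p (GW q))) {t. t \<noteq> empty_tree} =
      measure (measure_spmf (colored_branch p q)) (UNIV - {None})"
    by (simp add: colored_law_GW measure_map_spmf)
  also have "\<dots> = 1 - erased p"
    using weight_colored_branch[of p] measure_spmf.finite_measure_compl[of "{None}" "colored_branch p q"]
    by (simp add: spmf_conv_measure_spmf space_measure_spmf)
  finally show ?thesis .
qed

lemma spmf_colored_planted:
  "spmf (colored_law p (GW q)) (Node {#s#}) = spmf (colored_branch p q) (Some s)"
proof -
  have "(\<lambda>a. Node (add_option a {#})) -` {Node {#s#}} = {Some s}"
    by (auto simp: add_option_def split: option.splits)
  then show ?thesis
    by (simp add: colored_law_GW spmf_map spmf_conv_measure_spmf[symmetric])
qed

lemma cond_prob_planted:
  "\<P>(t in measure_spmf (colored_law p (GW q)). t = Node {#s#} \<bar> t \<noteq> empty_tree) = pruned p s"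
proof -
  have "{t. t = Node {#s#} \<and> t \<noteq> empty_tree} = {Node {#s#}}"
    by (auto simp: empty_tree_def)
  then show ?thesis
    by (simp add: cond_prob_def space_measure_spmf measure_colored_nonempty pruned_def
        spmf_conv_measure_spmf[symmetric] spmf_colored_planted)
qed

section \<open>Passage to the limit in the subcritical and critical cases\<close>

lemma tendsto_pruned_leaf:
  assumes "m < 1"
  shows "((\<lambda>p. pruned p (Node {#})) \<longlongrightarrow> 1) (at_left 1)"
proof (rule Lim_transform_eventually)
  show "((\<lambda>p. thinned q (erased p) 0) \<longlongrightarrow> 1) (at_left 1)"
    by (rule filterlim_compose[OF thinned_0_tendsto[OF assms] erased_tendsto])
  show "\<forall>\<^sub>F p in at_left 1. thinned q (erased p) 0 = pruned p (Node {#})"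
    using eventually_at_left_1_unit
    by (rule eventually_mono) (subst pruned_eq, auto)
qed

text \<open>Once a single tree carries conditional mass tending to 1, monotonicity sends every event
  containing it to 1, and additivity sends every other event to 0.\<close>

lemma subcritical_limit:
  assumes "m < 1"
  shows "((\<lambda>p. \<P>(t in measure_spmf (colored_law p (GW q)). t \<in> A \<bar> t \<noteq> empty_tree))
    \<longlongrightarrow> indicator A (Node {#Node {#}#})) (at_left 1)"
proof -
  define l where "l = Node {#Node {#}#}"
  define P where "P p A = measure (measure_spmf (colored_law p (GW q))) {t. t \<in> A \<and> t \<noteq> empty_tree} / (1 - erased p)"
    for p A
  have P: "\<P>(t in measure_spmf (colored_law p (GW q)). t \<in> A \<bar> t \<noteq> empty_tree) = P p A" for p A
    by (simp add: cond_prob_def space_measure_spmf measure_colored_nonempty P_def)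
  note ev = eventually_at_left_1_unit
  have Pl: "P p {l} = pruned p (Node {#})" for p
    using cond_prob_planted[of p "Node {#}"] P[of p "{l}"] by (simp add: l_def)
  have mono: "P p A \<le> P p B" if "A \<subseteq> B" "0 < p" "p < 1" for p A B
    unfolding P_def using that erased_less_1[of p]
    by (intro divide_right_mono measure_spmf.finite_measure_mono) auto
  have Ptot: "P p UNIV = 1" if "0 < p" "p < 1" for p
    using that erased_less_1[of p] by (simp add: P_def measure_colored_nonempty)
  have lim: "((\<lambda>p. P p {l}) \<longlongrightarrow> 1) (at_left 1)"
    using tendsto_pruned_leaf[OF assms] by (simp add: Pl)
  show ?thesis
  proof (cases "l \<in> A")
    case True
    have "((\<lambda>p. P p A) \<longlongrightarrow> 1) (at_left 1)"
    proof (rule tendsto_sandwich[OF _ _ lim tendsto_const])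
      show "\<forall>\<^sub>F p in at_left 1. P p {l} \<le> P p A"
        using ev by eventually_elim (use True in \<open>auto intro!: mono\<close>)
      show "\<forall>\<^sub>F p in at_left 1. P p A \<le> 1"
        using ev by eventually_elim (use mono[of A UNIV] Ptot in auto)
    qed
    with True show ?thesis by (simp add: P l_def)
  next
    case False
    have "((\<lambda>p. P p A) \<longlongrightarrow> 0) (at_left 1)"
    proof (rule tendsto_sandwich[OF _ _ tendsto_const])
      show "((\<lambda>p. 1 - P p {l}) \<longlongrightarrow> 0) (at_left 1)"
        using tendsto_diff[OF tendsto_const[of 1] lim] by simp
      show "\<forall>\<^sub>F p in at_left 1. 0 \<le> P p A"
        using ev by eventually_elim (auto simp: P_def pmf_le_1)
      show "\<forall>\<^sub>F p in at_left 1. P p A \<le> 1 - P p {l}"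
        using ev
      proof eventually_elim
        case (elim p)
        have "P p A + P p {l} = P p (A \<union> {l})"
          unfolding P_def add_divide_distrib[symmetric]
          by (subst measure_spmf.finite_measure_Union[symmetric])
            (use False in \<open>auto intro!: arg_cong2[where f = "(/)"] arg_cong2[where f = measure]\<close>)
        also have "\<dots> \<le> P p UNIV" by (rule mono) (use elim in auto)
        also have "\<dots> = 1" using Ptot elim by simp
        finally show ?case by simp
      qed
    qed
    with False show ?thesis by (simp add: P l_def)
  qed
qed

end

text \<open>\<open>pruned_eq\<close> and \<open>spmf_branch\<close> are the same recursion with
  different offspring weights; the weights converge, and structural induction carries this to each
  tree.\<close>

lemma (in regular_critical_offspring) tendsto_pruned:
  "((\<lambda>p. pruned p s) \<longlongrightarrow> spmf (branch (igw_offspring \<Lambda>)) s) (at_left 1)"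
proof (induction s)
  case (Node C)
  show ?case
  proof (rule Lim_transform_eventually)
    show "((\<lambda>p. thinned q (erased p) (size C) * sample_weight (pruned p) C)
        \<longlongrightarrow> spmf (branch (igw_offspring \<Lambda>)) (Node C)) (at_left 1)"
      unfolding spmf_branch[of _ "Node C"] tree.sel
      by (intro tendsto_intros tendsto_sample_weight Node filterlim_compose[OF thinned_tendsto erased_tendsto])
    show "\<forall>\<^sub>F p in at_left 1. thinned q (erased p) (size C) * sample_weight (pruned p) C = pruned p (Node C)"
      using eventually_at_left_1_unit by (rule eventually_mono) (subst pruned_eq, auto)
  qed
qed

lemma spmf_GW_planted: "spmf (GW r) (Node {#s#}) = spmf (branch r) s"
  using spmf_map_inj'[of Node "gw_forest r 1" "{#s#}"] by (simp add: GW_def spmf_gw_forest inj_def)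

lemma spmf_GW_empty: "spmf (GW r) empty_tree = 0"
  using spmf_map_inj'[of Node "gw_forest r 1" "{#}"]
  by (simp add: GW_def spmf_gw_forest inj_def empty_tree_def)

lemma GW_return_0: "GW (return_pmf 0) = return_spmf (Node {#Node {#}#})"
proof -
  have "branch (return_pmf 0) = return_spmf (Node {#})" by (simp add: branch_def)
  then show ?thesis by (simp add: GW_def gw_forest_Suc)
qed

lemma planted_treesE:
  assumes "\<tau> \<in> planted_trees"
  obtains "\<tau> = empty_tree" | s where "\<tau> = Node {#s#}"
proof (cases "\<tau> = empty_tree")
  case False
  with assms have "size (subtrees \<tau>) = 1" by (auto simp: planted_trees_def planted_def)
  then obtain s where "subtrees \<tau> = {#s#}" using size_1_singleton_mset by blast
  then show ?thesis using that(2) tree.collapse[of \<tau>] by metis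
qed (use that in auto)

theorem theorem9:
  fixes q :: "nat pmf"
  assumes "pmf q 1 = 0"
  shows "(critical q \<and>
          (\<exists>\<Lambda>. ((\<lambda>x. (progeny_gf q x - x) / ((1 - x) * (1 - deriv (progeny_gf q) x)))
                 \<longlongrightarrow> \<Lambda>) (at_left 1))
          \<longrightarrow>
          (\<exists>L. ((\<lambda>x. ln (g_fun q x) / (- ln (1 - x))) \<longlongrightarrow> L) (at_left 1) \<and>
               (\<forall>\<tau>\<in>planted_trees.
                  ((\<lambda>p. \<P>(t in measure_spmf (colored_law p (GW q)). t = \<tau> \<bar> t \<noteq> empty_tree))
                    \<longlongrightarrow> spmf (IGW (1 / (2 - L))) \<tau>) (at_left 1))))
         \<and>
         (subcritical q
          \<longrightarrow>
          (\<forall>A\<subseteq>planted_trees.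
             ((\<lambda>p. \<P>(t in measure_spmf (colored_law p (GW q)). t \<in> A \<bar> t \<noteq> empty_tree))
               \<longlongrightarrow> measure (measure_spmf (GW (return_pmf 0))) A) (at_left 1)))"
proof (intro conjI impI allI)
  assume "critical q \<and> (\<exists>\<Lambda>. ((\<lambda>x. (progeny_gf q x - x) / ((1 - x) * (1 - deriv (progeny_gf q) x)))
                 \<longlongrightarrow> \<Lambda>) (at_left 1))"
  then obtain \<Lambda> where crit: "critical q" and
    \<Lambda>: "((\<lambda>x. (progeny_gf q x - x) / ((1 - x) * (1 - deriv (progeny_gf q) x))) \<longlongrightarrow> \<Lambda>) (at_left 1)"
    by blast
  interpret critical_offspring q
    by unfold_locales (use assms crit in \<open>simp_all add: critical_def\<close>)
  \<comment> \<open>Close to 1 from below, \<open>deriv Q\<close> agrees with the termwise series,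
    so the hypothesis transfers to \<open>Q'\<close>.\<close>
  have "((\<lambda>x. (Q x - x) / ((1 - x) * (1 - Q' x))) \<longlongrightarrow> \<Lambda>) (at_left 1)"
    using \<Lambda>
  proof (rule Lim_transform_eventually)
    show "\<forall>\<^sub>F x in at_left 1. (Q x - x) / ((1 - x) * (1 - deriv Q x)) = (Q x - x) / ((1 - x) * (1 - Q' x))"
      using eventually_at_left_1_unit
      by (rule eventually_mono) (simp add: DERIV_imp_deriv[OF has_derivative_progeny_gf])
  qed
  then interpret regular_critical_offspring q \<Lambda>
    by unfold_locales
  have "((\<lambda>p. \<P>(t in measure_spmf (colored_law p (GW q)). t = \<tau> \<bar> t \<noteq> empty_tree))
      \<longlongrightarrow> spmf (IGW \<Lambda>) \<tau>) (at_left 1)" if "\<tau> \<in> planted_trees" for \<tau>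
    using that
  proof (cases rule: planted_treesE)
    case 1
    \<comment> \<open>Conditioning excludes the empty tree, and \<open>IGW\<close> gives it no mass
      either because its root has one offspring.\<close>
    have "{t :: tree. t = empty_tree \<and> t \<noteq> empty_tree} = {}" by auto
    then show ?thesis
      by (simp add: 1 IGW_def spmf_GW_empty cond_prob_def)
  next
    case (2 s)
    then show ?thesis
      by (simp add: cond_prob_planted IGW_def spmf_GW_planted tendsto_pruned)
  qed
  \<comment> \<open>The witness \<open>2 - 1 / \<Lambda>\<close> turns \<open>1 / (2 - L)\<close>
    into \<open>\<Lambda>\<close>.\<close>
  then show "\<exists>L. ((\<lambda>x. ln (g_fun q x) / (- ln (1 - x))) \<longlongrightarrow> L) (at_left 1) \<and>
               (\<forall>\<tau>\<in>planted_trees.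
                  ((\<lambda>p. \<P>(t in measure_spmf (colored_law p (GW q)). t = \<tau> \<bar> t \<noteq> empty_tree))
                    \<longlongrightarrow> spmf (IGW (1 / (2 - L))) \<tau>) (at_left 1))"
    using ln_g_fun_tendsto by (intro exI[of _ "2 - 1 / \<Lambda>"]) auto
next
  fix A :: "tree set"
  assume "subcritical q" "A \<subseteq> planted_trees"
  then obtain m where m: "m < 1" "(\<lambda>k. real k * pmf q k) sums m"
    by (auto simp: subcritical_def)
  interpret offspring q m
    by unfold_locales (use assms m in auto)
  have "measure (measure_spmf (GW (return_pmf 0))) A = indicator A (Node {#Node {#}#})"
    by (simp add: GW_return_0 measure_spmf_return_spmf measure_return)
  then show "((\<lambda>p. \<P>(t in measure_spmf (colored_law p (GW q)). t \<in> A \<bar> t \<noteq> empty_tree))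
      \<longlongrightarrow> measure (measure_spmf (GW (return_pmf 0))) A) (at_left 1)"
    using subcritical_limit[OF m(1), of A] by simp
qed

end
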